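(* Let $\mu = k^2\sup_{x\in\Omega}\int_\Omega |G(x,y)|\,dy$, write $\|u_0\|=\|u_0\|_{C(\overline\Omega\times\partial\Omega)}$, let $\|\mathcal{K}_1\|$ be the operator norm of $\mathcal{K}_1: C(\partial\Omega\times\partial\Omega)\to L^\infty(\Omega)$, and set $$C=\max\Big\{2,\ \frac{81}{8}\,\mu\,\|\mathcal{K}_1\|\,\|u_0\|^3\Big\},\qquad r=\frac{2}{27\mu\|u_0\|^2}\Big[\sqrt{16C^2+1}-4C\Big].$$ Let $\beta\in L^\infty(\Omega)$. Suppose that the Born series $\phi=\sum_{n=1}^\infty K_n(\beta,\dots,\beta)$ converges, that $\|\mathcal{K}_1\phi\|_\infty<r$, and that the inverse Born series $\tilde\beta=\sum_{m=1}^\infty\mathcal{K}_m(\phi)$ converges, with sum $\tilde\beta$. Let $\mathcal{M}=\max\{\|\beta\|_\infty,\|\tilde\beta\|_\infty\}$ and assume further that $$\mathcal{M}<\frac{4}{27\mu\|u_0\|^2}\left(1-\sqrt{\frac{\frac{81}{8}\mu\|\mathcal{K}_1\|\|u_0\|^3}{1+\frac{81}{8}\mu\|\mathcal{K}_1\|\|u_0\|^3}}\right).$$ Then $$\|\beta-\tilde\beta\|_\infty\le\left(1-\frac{\frac{81}{8}\mu\|\mathcal{K}_1\|\|u_0\|^3}{\big(1-\frac{27}{4}\mu\|u_0\|^2\mathcal{M}\big)^2}+\frac{81}{8}\mu\|\mathcal{K}_1\|\|u_0\|^3\right)^{-1}\big\|(I-\mathcal{K}_1K_1)\beta\big\|_\infty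 .$$
   Context: Setting. $\Omega\subset\mathbb{R}^d$, $d\ge 2$, is a bounded domain with smooth boundary, and $k$ is real such that $-k^2$ is not a Neumann eigenvalue of the Laplacian on $\Omega$. $G$ is the Neumann Green's function: $\Delta_x G(x,y)+k^2G(x,y)=\delta(x-y)$ in $\Omega$ with zero normal derivative on $\partial\Omega$. The nonlinear problem is $\Delta u+k^2u+k^2\beta u^3=0$ in $\Omega$, $\partial u/\partial\nu=g$ on $\partial\Omega$ (here $\partial/\partial\nu$ is the outward normal derivative), with $\beta\in L^\infty(\Omega)$ real valued; the scattering data are $\phi=u-u_0$ on the boundary, represented by the Born series. A family of real sources $g=g_s$ indexed by $s\in\partial\Omega$ is used; $u_0(\cdot,s)$ is the solution of the linear problem $\Delta u_0+k^2u_0=0$ in $\Omega$, $\partial u_0/\partial\nu=g_s$ on $\partial\Omega$, and $u_0$ is viewed as a function in $C(\overline\Omega\times\partial\Omega)$, not identically zero. Forward operators. For $v\in C(\overline\Omega\times\partial\Omega)$ and $\beta\in L^\infty(\Omega)$ put $b(v,\beta)(x,s)=-k^2\int_\Omega G(x,y)\beta(y)v(y,s)\,dy$. For a multilinear operator $T_l$ of order $l$ (with values in functions of $(x,s)$), $BT_l$ is the multilinear operator of order $l+1$ given by $BT_l(\beta_1,\dots,\beta_{l+1})=b(T_l(\beta_1,\dots,\beta_l),\beta_{l+1})$. For multilinear $T_l,T_j$ of orders $l,j$, $T_l\otimes T_j(\beta_1,\dots,\beta_{l+j})=T_l(\beta_1,\dots,\beta_l)\,T_j(\beta_{l+1},\dots,\beta_{l+j})$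 (pointwise product). The operators $K_n$ (multilinear of order $n$) are defined by $K_0=u_0$ and, for $n\ge0$, $$K_{n+1}=B\sum_{\substack{i_1+i_2+i_3=n\\ 0\le i_1,i_2,i_3\le n}}K_{i_1}\otimes K_{i_2}\otimes K_{i_3}.$$ After the recursion, $K_n(\beta_1,\dots,\beta_n)$ is restricted to $\partial\Omega\times\partial\Omega$, so $K_n:[L^\infty(\Omega)]^n\to C(\partial\Omega\times\partial\Omega)$; the Born series for $\phi$ is a series in $C(\partial\Omega\times\partial\Omega)$. Inverse operators. $\mathcal{K}_1=K_1^+$ is some fixed regularized pseudoinverse of $K_1$, a bounded linear operator $C(\partial\Omega\times\partial\Omega)\to L^\infty(\Omega)$ (no further property of it is specified). For $m\ge2$, $$\mathcal{K}_m(\phi)=-\sum_{n=2}^m\ \sum_{\substack{i_1+\cdots+i_n=m\\ i_j\ge1}}\mathcal{K}_1K_n\big(\mathcal{K}_{i_1}(\phi),\dots,\mathcal{K}_{i_n}(\phi)\big).$$ The inverse Born series is a series in $L^\infty(\Omega)$. All $C(\cdot)$ norms are sup norms. *)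

theory Defs
  imports "HOL-Analysis.Analysis" "HOL-Probability.Essential_Supremum"
begin

section \<open>Differential operators and domains\<close>

definition partial :: "'a::euclidean_space \<Rightarrow> ('a \<Rightarrow> real) \<Rightarrow> 'a \<Rightarrow> real" where
  "partial i u x = frechet_derivative u (at x) i"

definition laplacian :: "('a::euclidean_space \<Rightarrow> real) \<Rightarrow> 'a \<Rightarrow> real" where
  "laplacian u x = (\<Sum>i\<in>Basis. partial i (partial i u) x)"

text \<open>Functions of class \<open>C\<^sup>n\<close> on \<open>U\<close>; only used for open \<open>U\<close>.\<close>

primrec C_on :: "nat \<Rightarrow> 'a::euclidean_space set \<Rightarrow> ('a \<Rightarrow> real) \<Rightarrow> bool" where
  "C_on 0 U u \<longleftrightarrow> continuous_on U u"
| "C_on (Suc n) U u \<longleftrightarrow>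
     (\<forall>x\<in>U. u differentiable (at x)) \<and> (\<forall>i\<in>Basis. C_on n U (partial i u))"

definition smooth_on :: "'a::euclidean_space set \<Rightarrow> ('a \<Rightarrow> real) \<Rightarrow> bool" where
  "smooth_on U u \<longleftrightarrow> (\<forall>n. C_on n U u)"

text \<open>Near \<open>p\<close>, the set \<open>\<Omega>\<close> is a strict sublevel set of the smooth function \<open>\<rho>\<close>, whose gradient
  \<open>D\<close> at \<open>p\<close> is nonzero (and hence points out of \<open>\<Omega>\<close>).\<close>

definition boundary_defining ::
    "'a::euclidean_space set \<Rightarrow> 'a \<Rightarrow> ('a \<Rightarrow> real) \<Rightarrow> 'a \<Rightarrow> bool" where
  "boundary_defining \<Omega> p \<rho> D \<longleftrightarrow>
     (\<exists>U. open U \<and> p \<in> U \<and> smooth_on U \<rho> \<and>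
          \<Omega> \<inter> U = {x \<in> U. \<rho> x < 0} \<and> frontier \<Omega> \<inter> U = {x \<in> U. \<rho> x = 0}) \<and>
     GDERIV \<rho> p :> D \<and> D \<noteq> 0"

definition smooth_bounded_domain :: "'a::euclidean_space set \<Rightarrow> bool" where
  "smooth_bounded_domain \<Omega> \<longleftrightarrow>
     open \<Omega> \<and> connected \<Omega> \<and> \<Omega> \<noteq> {} \<and> bounded \<Omega> \<and>
     (\<forall>p\<in>frontier \<Omega>. \<exists>\<rho> D. boundary_defining \<Omega> p \<rho> D)"

definition outward_normal :: "'a::euclidean_space set \<Rightarrow> 'a \<Rightarrow> 'a" where
  "outward_normal \<Omega> p = (THE \<nu>. \<exists>\<rho> D. boundary_defining \<Omega> p \<rho> D \<and> \<nu> = D /\<^sub>R norm D)"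

text \<open>The outward normal derivative is taken from inside the domain; the sign comes from moving
  along the inward normal.\<close>

definition has_normal_derivative ::
    "'a::euclidean_space set \<Rightarrow> ('a \<Rightarrow> real) \<Rightarrow> real \<Rightarrow> 'a \<Rightarrow> bool" where
  "has_normal_derivative \<Omega> u c p \<longleftrightarrow>
     ((\<lambda>t. u (p - t *\<^sub>R outward_normal \<Omega> p)) has_real_derivative (- c)) (at_right 0)"

text \<open>The gradient, defined on \<open>\<Omega> - P\<close>, has to extend continuously to the boundary.\<close>

definition C1_closure_except :: "'a::euclidean_space set \<Rightarrow> 'a set \<Rightarrow> ('a \<Rightarrow> real) \<Rightarrow> bool" where
  "C1_closure_except P \<Omega> u \<longleftrightarrow>
     continuous_on (closure \<Omega> - P) u \<and>
     (\<exists>D. continuous_on (closure \<Omega> - P) D \<and> (\<forall>x\<in>\<Omega> - P. GDERIV u x :> D x))"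

section \<open>The Neumann problem for the Helmholtz equation\<close>

definition neumann_solution ::
    "'a::euclidean_space set \<Rightarrow> real \<Rightarrow> ('a \<Rightarrow> real) \<Rightarrow> ('a \<Rightarrow> real) \<Rightarrow> bool" where
  "neumann_solution \<Omega> l g u \<longleftrightarrow>
     C_on 2 \<Omega> u \<and> (\<forall>x\<in>\<Omega>. laplacian u x = l * u x) \<and>
     (\<forall>p\<in>frontier \<Omega>. has_normal_derivative \<Omega> u (g p) p)"

text \<open>The eigenvalue convention is \<open>\<Delta>u = \<lambda>u\<close>, so the eigenvalues are nonpositive.\<close>

definition neumann_eigenvalue :: "'a::euclidean_space set \<Rightarrow> real \<Rightarrow> bool" where
  "neumann_eigenvalue \<Omega> l \<longleftrightarrow>
     (\<exists>u. C1_closure_except {} \<Omega> u \<and> neumann_solution \<Omega> l (\<lambda>_. 0) u \<and> (\<exists>x\<in>\<Omega>. u x \<noteq> 0))"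

definition test_function :: "'a::euclidean_space set \<Rightarrow> ('a \<Rightarrow> real) \<Rightarrow> bool" where
  "test_function \<Omega> \<psi> \<longleftrightarrow>
     smooth_on UNIV \<psi> \<and> (\<exists>K. compact K \<and> K \<subseteq> \<Omega> \<and> (\<forall>x. x \<notin> K \<longrightarrow> \<psi> x = 0))"

text \<open>Weakly singular kernels in the sense of potential theory. The Green's functions below have
  singularity \<open>\<bar>x - y\<bar>\<^bsup>2 - d\<^esup>\<close> if \<open>d > 2\<close> and \<open>log \<bar>x - y\<bar>\<close> if \<open>d = 2\<close>, so they are weakly singular
  with any exponent \<open>\<alpha> < 2\<close>. The value on the diagonal is irrelevant.\<close>

definition weakly_singular :: "'a::euclidean_space set \<Rightarrow> ('a \<Rightarrow> 'a \<Rightarrow> real) \<Rightarrow> bool" where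
  "weakly_singular \<Omega> G \<longleftrightarrow>
     continuous_on {(x, y). x \<in> closure \<Omega> \<and> y \<in> \<Omega> \<and> x \<noteq> y} (\<lambda>(x, y). G x y) \<and>
     (\<exists>\<alpha>>0. \<exists>M. \<forall>x\<in>closure \<Omega>. \<forall>y\<in>\<Omega>. x \<noteq> y \<longrightarrow>
        \<bar>G x y\<bar> \<le> M * dist x y powr (\<alpha> - real DIM('a)))"

text \<open>The equation \<open>\<Delta>\<^sub>x G(x,y) + k\<^sup>2 G(x,y) = \<delta>(x - y)\<close> is understood in the sense of distributions.\<close>

definition neumann_green ::
    "'a::euclidean_space set \<Rightarrow> real \<Rightarrow> ('a \<Rightarrow> 'a \<Rightarrow> real) \<Rightarrow> bool" where
  "neumann_green \<Omega> k G \<longleftrightarrow>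
     weakly_singular \<Omega> G \<and>
     (\<forall>y\<in>\<Omega>.
        (\<forall>\<psi>. test_function \<Omega> \<psi> \<longrightarrow>
           (LINT x|lebesgue_on \<Omega>. G x y * (laplacian \<psi> x + k\<^sup>2 * \<psi> x)) = \<psi> y) \<and>
        C1_closure_except {y} \<Omega> (\<lambda>x. G x y) \<and>
        (\<forall>p\<in>frontier \<Omega>. has_normal_derivative \<Omega> (\<lambda>x. G x y) 0 p))"

section \<open>Function spaces\<close>

text \<open>Elements of \<open>L\<^sup>\<infinity>(\<Omega>)\<close> are represented by functions, identified when equal almost everywhere
  on \<open>\<Omega>\<close>; elements of \<open>C(S)\<close> are represented by functions of which only the values on \<open>S\<close> matter.\<close>

definition Linf :: "'a::euclidean_space set \<Rightarrow> ('a \<Rightarrow> real) set" where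
  "Linf \<Omega> = {f \<in> borel_measurable (lebesgue_on \<Omega>). \<exists>c. AE x in lebesgue_on \<Omega>. \<bar>f x\<bar> \<le> c}"

definition Linf_norm :: "'a::euclidean_space set \<Rightarrow> ('a \<Rightarrow> real) \<Rightarrow> real" where
  "Linf_norm \<Omega> f = real_of_ereal (esssup (lebesgue_on \<Omega>) (\<lambda>x. ereal \<bar>f x\<bar>))"

definition sup_norm :: "'b set \<Rightarrow> ('b \<Rightarrow> real) \<Rightarrow> real" where
  "sup_norm S f = (SUP z\<in>S. \<bar>f z\<bar>)"

abbreviation bdry2 :: "'a::euclidean_space set \<Rightarrow> ('a \<times> 'a) set" where
  "bdry2 \<Omega> \<equiv> frontier \<Omega> \<times> frontier \<Omega>"

text \<open>Bounded linear operators from \<open>C(\<partial>\<Omega> \<times> \<partial>\<Omega>)\<close> to \<open>L\<^sup>\<infinity>(\<Omega>)\<close>. Linearity together with the bound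
  makes \<open>T f\<close>, as an element of \<open>L\<^sup>\<infinity>(\<Omega>)\<close>, depend only on \<open>f\<close> restricted to \<open>\<partial>\<Omega> \<times> \<partial>\<Omega>\<close>.\<close>

definition bounded_linear_C_Linf ::
    "'a::euclidean_space set \<Rightarrow> (('a \<times> 'a \<Rightarrow> real) \<Rightarrow> 'a \<Rightarrow> real) \<Rightarrow> bool" where
  "bounded_linear_C_Linf \<Omega> T \<longleftrightarrow>
     (\<forall>f. continuous_on (bdry2 \<Omega>) f \<longrightarrow> T f \<in> Linf \<Omega>) \<and>
     (\<forall>f h. continuous_on (bdry2 \<Omega>) f \<longrightarrow> continuous_on (bdry2 \<Omega>) h \<longrightarrow>
        (AE x in lebesgue_on \<Omega>. T (\<lambda>z. f z + h z) x = T f x + T h x)) \<and>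
     (\<forall>c f. continuous_on (bdry2 \<Omega>) f \<longrightarrow>
        (AE x in lebesgue_on \<Omega>. T (\<lambda>z. c * f z) x = c * T f x)) \<and>
     (\<exists>B. \<forall>f. continuous_on (bdry2 \<Omega>) f \<longrightarrow> Linf_norm \<Omega> (T f) \<le> B * sup_norm (bdry2 \<Omega>) f)"

text \<open>As in \<^const>\<open>onorm\<close>, the quotient at zero is \<open>0\<close> by convention.\<close>

definition onorm_C_Linf ::
    "'a::euclidean_space set \<Rightarrow> (('a \<times> 'a \<Rightarrow> real) \<Rightarrow> 'a \<Rightarrow> real) \<Rightarrow> real" where
  "onorm_C_Linf \<Omega> T =
     (SUP f\<in>{f. continuous_on (bdry2 \<Omega>) f}. Linf_norm \<Omega> (T f) / sup_norm (bdry2 \<Omega>) f)"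

section \<open>Forward and inverse operators\<close>

text \<open>A multilinear operator of order \<open>n\<close> takes the list of its \<open>n\<close> arguments and yields a function
  of \<open>(x, s)\<close>.\<close>

type_synonym 'a multiop = "('a \<Rightarrow> real) list \<Rightarrow> 'a \<times> 'a \<Rightarrow> real"

definition b_op ::
    "'a::euclidean_space set \<Rightarrow> real \<Rightarrow> ('a \<Rightarrow> 'a \<Rightarrow> real) \<Rightarrow>
     ('a \<times> 'a \<Rightarrow> real) \<Rightarrow> ('a \<Rightarrow> real) \<Rightarrow> 'a \<times> 'a \<Rightarrow> real" where
  "b_op \<Omega> k G v \<beta> = (\<lambda>(x, s). - k\<^sup>2 * (LINT y|lebesgue_on \<Omega>. G x y * \<beta> y * v (y, s)))"

definition B_op ::
    "'a::euclidean_space set \<Rightarrow> real \<Rightarrow> ('a \<Rightarrow> 'a \<Rightarrow> real) \<Rightarrow> 'a multiop \<Rightarrow> 'a multiop" where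
  "B_op \<Omega> k G T \<beta>s = b_op \<Omega> k G (T (butlast \<beta>s)) (last \<beta>s)"

text \<open>\<open>T \<otimes> S\<close>, where \<open>l\<close> is the order of \<open>T\<close>.\<close>

definition tensor :: "nat \<Rightarrow> 'a multiop \<Rightarrow> 'a multiop \<Rightarrow> 'a multiop" where
  "tensor l T S \<beta>s = (\<lambda>z. T (take l \<beta>s) z * S (drop l \<beta>s) z)"

fun born ::
    "'a::euclidean_space set \<Rightarrow> real \<Rightarrow> ('a \<Rightarrow> 'a \<Rightarrow> real) \<Rightarrow> ('a \<times> 'a \<Rightarrow> real) \<Rightarrow>
     nat \<Rightarrow> 'a multiop" where
  "born \<Omega> k G u0 0 = (\<lambda>_. u0)"
| "born \<Omega> k G u0 (Suc n) = B_op \<Omega> k G (\<lambda>\<beta>s z.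
     \<Sum>(i, j, l)\<in>{(i, j, l). i + j + l = n}.
       tensor (i + j) (tensor i (born \<Omega> k G u0 i) (born \<Omega> k G u0 j)) (born \<Omega> k G u0 l) \<beta>s z)"

lemma part_less:
  assumes "i \<in> set is" "\<forall>i\<in>set is. (i::nat) \<ge> 1" "length is \<ge> 2"
  shows "i < sum_list is"
proof -
  have le: "length xs \<le> sum_list xs" if "\<forall>i\<in>set xs. (i::nat) \<ge> 1" for xs
    using that by (induction xs) auto
  obtain xs ys where "is = xs @ i # ys"
    using assms(1) by (meson in_set_conv_decomp)
  then show ?thesis
    using le[of xs] le[of ys] assms(2,3) by auto
qed

text \<open>The inverse operators evaluated at \<open>\<phi>\<close>, for a family \<open>K\<close> of forward operators and the
  regularized pseudoinverse \<open>T\<close> of \<open>K 1\<close>. Only the orders \<open>m \<ge> 1\<close> are meaningful.\<close>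

function inverse_born ::
    "(nat \<Rightarrow> 'a multiop) \<Rightarrow> (('a \<times> 'a \<Rightarrow> real) \<Rightarrow> 'a \<Rightarrow> real) \<Rightarrow> ('a \<times> 'a \<Rightarrow> real) \<Rightarrow>
     nat \<Rightarrow> 'a \<Rightarrow> real" where
  "inverse_born K T \<phi> m =
     (if m = 0 then (\<lambda>_. 0)
      else if m = 1 then T \<phi>
      else (\<lambda>x. - (\<Sum>n = 2..m.
              \<Sum>is\<in>{is. length is = n \<and> sum_list is = m \<and> (\<forall>i\<in>set is. i \<ge> 1)}.
                T (K n (map (inverse_born K T \<phi>) is)) x)))"
  by pat_completeness auto
termination
proof (relation "Wellfounded.measure (\<lambda>(K, T, \<phi>, m). m)", goal_cases)
  case 1
  show ?case by simp
next
  case 2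
  then show ?case by (auto intro: part_less)
qed

declare inverse_born.simps [simp del]

end

theory Submission
  imports Defs
begin

text \<open>
  Write \<open>T\<close> for the pseudoinverse of \<open>K 1\<close>, and \<open>p = 27/4 * \<mu> * N^2\<close>, \<open>\<sigma> = 81/8 * \<mu> * \<kappa> * N^3\<close>.
  Applying \<open>T\<close> to the Born series gives \<open>T \<phi> = (\<Sum>n\<ge>1. T (K n (\<beta>, ..., \<beta>)))\<close>, and the inverse series is
  constructed so that its sum solves \<open>\<beta>' = T \<phi> - (\<Sum>n\<ge>2. T (K n (\<beta>', ..., \<beta>')))\<close>. Subtracting,
  \<open>\<beta> - \<beta>' = (\<beta> - T (K 1 \<beta>)) - (\<Sum>n\<ge>2. T (K n (\<beta>, ..., \<beta>)) - T (K n (\<beta>', ..., \<beta>')))\<close>.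
  The nonlinear sum is Lipschitz on the ball of radius \<open>M\<close>, with constant
  \<open>L = \<sigma> * (1 / (1 - p * M)^2 - 1)\<close>; the bound on \<open>M\<close> is the condition \<open>L < 1\<close>, and the claim is
  \<open>norm (\<beta> - \<beta>') \<le> norm (\<beta> - T (K 1 \<beta>)) / (1 - L)\<close>.

  The constants come from the cubic nonlinearity. The recursion bounds the norm of \<open>K n\<close> by
  \<open>N^(2n+1) * \<mu>^n\<close> times the number of ternary trees with \<open>n\<close> nodes (\<open>bounded_multilinear_born\<close>), and that
  number is at most \<open>3/2 * (27/4)^n\<close> (\<open>ternary_trees_le\<close>). So \<open>T \<circ> K n\<close> has norm at most \<open>\<sigma> * p^(n-1)\<close>, and
  \<open>L\<close> is the sum of the terms \<open>n * \<sigma> * (p * M)^(n-1)\<close> over \<open>n \<ge> 2\<close>. That the \<open>K n\<close> are bounded operators into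
  continuous functions up to the boundary rests on the weak singularity of the Green's function
  (\<open>continuous_integral_operator\<close>, \<open>integral_abs_kernel_le\<close>).

  The equation for \<open>\<beta>'\<close> rearranges a double series, and this is what the smallness of \<open>T \<phi>\<close> is for. It makes
  \<open>(\<Sum>j. 2^j * norm (\<eta> j))\<close> finite, where \<open>\<eta> j\<close> are the terms of the inverse series
  (\<open>weighted_norm_sum_le\<close>). The \<open>m\<close>th partial sum solves the equation up to terms of total order above \<open>m\<close>
  (\<open>\<eta>_sum_identity\<close>), which by the weights are \<open>O(2^-m)\<close> (\<open>norm_remainder_le\<close>). So the subtraction is done
  for partial sums (\<open>error_le\<close>), and the estimate follows as \<open>m\<close> tends to infinity.
\<close>

section \<open>The space of essentially bounded functions\<close>

lemma Linf_measurable: "f \<in> Linf \<Omega> \<Longrightarrow> f \<in> borel_measurable (lebesgue_on \<Omega>)"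
  by (simp add: Linf_def)

lemma Linf_norm_nonneg: "0 \<le> Linf_norm \<Omega> f"
proof -
  let ?M = "lebesgue_on \<Omega>" and ?f = "\<lambda>x. ereal \<bar>f x\<bar>"
  show ?thesis
  proof (cases "?f \<in> borel_measurable ?M")
    case meas: True
    show ?thesis
    proof (cases "emeasure ?M (space ?M) = 0")
      case True
      then show ?thesis
        by (simp add: Linf_norm_def esssup_zero_space[OF _ meas])
    next
      case False
      have "0 = esssup ?M (\<lambda>x. 0 :: ereal)"
        using esssup_const[OF False, of "0 :: ereal"] by simp
      also have "\<dots> \<le> esssup ?M ?f"
        by (rule esssup_mono) auto
      finally show ?thesis
        by (simp add: Linf_norm_def real_of_ereal_pos)
    qed
  next
    case False
    then show ?thesis
      by (simp add: Linf_norm_def esssup_non_measurable top_ereal_def)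
  qed
qed

text \<open>Passing from the extended to the real norm is harmless on \<^const>\<open>Linf\<close>: there the essential
  supremum is never \<open>\<infinity>\<close>, the one value whose conversion to \<open>0\<close> would falsify the estimate.\<close>

lemma AE_le_Linf_norm:
  assumes "f \<in> Linf \<Omega>"
  shows "AE x in lebesgue_on \<Omega>. \<bar>f x\<bar> \<le> Linf_norm \<Omega> f"
proof -
  let ?M = "lebesgue_on \<Omega>" and ?f = "\<lambda>x. ereal \<bar>f x\<bar>"
  obtain c where c: "AE x in ?M. \<bar>f x\<bar> \<le> c" and [measurable]: "f \<in> borel_measurable ?M"
    using assms by (auto simp: Linf_def)
  have "esssup ?M ?f \<le> ereal c"
    by (rule esssup_I) (use c in auto)
  then have "ereal \<bar>a\<bar> \<le> esssup ?M ?f \<Longrightarrow> \<bar>a\<bar> \<le> Linf_norm \<Omega> f" for a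
    by (cases "esssup ?M ?f") (auto simp: Linf_norm_def)
  then show ?thesis
    using esssup_AE[of ?f ?M] by auto
qed

text \<open>The condition \<open>0 \<le> c\<close> matters on null sets, where the essential supremum is \<open>-\<infinity>\<close> and the norm is \<open>0\<close>.\<close>

lemma Linf_norm_le:
  assumes "f \<in> Linf \<Omega>" "AE x in lebesgue_on \<Omega>. \<bar>f x\<bar> \<le> c" "0 \<le> c"
  shows "Linf_norm \<Omega> f \<le> c"
proof -
  let ?M = "lebesgue_on \<Omega>" and ?f = "\<lambda>x. ereal \<bar>f x\<bar>"
  have [measurable]: "f \<in> borel_measurable ?M"
    using assms by (simp add: Linf_def)
  have "esssup ?M ?f \<le> ereal c"
    by (rule esssup_I) (use assms in auto)
  then show ?thesis
    using \<open>0 \<le> c\<close> by (cases "esssup ?M ?f") (auto simp: Linf_norm_def)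
qed

lemma Linf_zero: "(\<lambda>x. 0) \<in> Linf \<Omega>"
  by (auto simp: Linf_def intro!: exI[of _ 0])

lemma Linf_add:
  assumes "f \<in> Linf \<Omega>" "h \<in> Linf \<Omega>"
  shows "(\<lambda>x. f x + h x) \<in> Linf \<Omega>"
proof -
  have "AE x in lebesgue_on \<Omega>. \<bar>f x + h x\<bar> \<le> Linf_norm \<Omega> f + Linf_norm \<Omega> h"
    using AE_le_Linf_norm[OF assms(1)] AE_le_Linf_norm[OF assms(2)] by eventually_elim auto
  then show ?thesis
    using assms by (auto simp: Linf_def)
qed

lemma Linf_uminus: "f \<in> Linf \<Omega> \<Longrightarrow> (\<lambda>x. - f x) \<in> Linf \<Omega>"
  by (auto simp: Linf_def)

lemma Linf_diff: "f \<in> Linf \<Omega> \<Longrightarrow> h \<in> Linf \<Omega> \<Longrightarrow> (\<lambda>x. f x - h x) \<in> Linf \<Omega>"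
  using Linf_add[OF _ Linf_uminus, of f \<Omega> h] by simp

lemma Linf_sum: "(\<And>i. i \<in> I \<Longrightarrow> f i \<in> Linf \<Omega>) \<Longrightarrow> (\<lambda>x. \<Sum>i\<in>I. f i x) \<in> Linf \<Omega>"
  by (induction I rule: infinite_finite_induct) (auto intro: Linf_zero Linf_add)

lemma Linf_norm_triangle:
  assumes "f \<in> Linf \<Omega>" "h \<in> Linf \<Omega>"
  shows "Linf_norm \<Omega> (\<lambda>x. f x + h x) \<le> Linf_norm \<Omega> f + Linf_norm \<Omega> h"
proof (rule Linf_norm_le)
  show "AE x in lebesgue_on \<Omega>. \<bar>f x + h x\<bar> \<le> Linf_norm \<Omega> f + Linf_norm \<Omega> h"
    using AE_le_Linf_norm[OF assms(1)] AE_le_Linf_norm[OF assms(2)] by eventually_elim auto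
qed (auto intro: Linf_add assms Linf_norm_nonneg add_nonneg_nonneg)

lemma Linf_norm_cong_AE:
  assumes "f \<in> Linf \<Omega>" "h \<in> Linf \<Omega>" "AE x in lebesgue_on \<Omega>. f x = h x"
  shows "Linf_norm \<Omega> f = Linf_norm \<Omega> h"
proof (rule antisym; rule Linf_norm_le)
  show "AE x in lebesgue_on \<Omega>. \<bar>f x\<bar> \<le> Linf_norm \<Omega> h"
    using AE_le_Linf_norm[OF assms(2)] assms(3) by eventually_elim auto
  show "AE x in lebesgue_on \<Omega>. \<bar>h x\<bar> \<le> Linf_norm \<Omega> f"
    using AE_le_Linf_norm[OF assms(1)] assms(3) by eventually_elim auto
qed (auto intro: assms Linf_norm_nonneg)

lemma Linf_norm_uminus: "Linf_norm \<Omega> (\<lambda>x. - f x) = Linf_norm \<Omega> f"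
  by (simp add: Linf_norm_def)

lemma Linf_norm_minus_commute: "Linf_norm \<Omega> (\<lambda>x. f x - h x) = Linf_norm \<Omega> (\<lambda>x. h x - f x)"
  by (simp add: Linf_norm_def abs_minus_commute)

lemma Linf_norm_diff_triangle:
  assumes "f \<in> Linf \<Omega>" "h \<in> Linf \<Omega>"
  shows "Linf_norm \<Omega> (\<lambda>x. f x - h x) \<le> Linf_norm \<Omega> f + Linf_norm \<Omega> h"
  using Linf_norm_triangle[OF assms(1) Linf_uminus[OF assms(2)]] by (simp add: Linf_norm_uminus)

lemma Linf_norm_sum:
  "(\<And>i. i \<in> I \<Longrightarrow> f i \<in> Linf \<Omega>) \<Longrightarrow>
    Linf_norm \<Omega> (\<lambda>x. \<Sum>i\<in>I. f i x) \<le> (\<Sum>i\<in>I. Linf_norm \<Omega> (f i))"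
proof (induction I rule: infinite_finite_induct)
  case (insert i I)
  have "Linf_norm \<Omega> (\<lambda>x. f i x + (\<Sum>i\<in>I. f i x)) \<le> Linf_norm \<Omega> (f i) + Linf_norm \<Omega> (\<lambda>x. \<Sum>i\<in>I. f i x)"
    by (intro Linf_norm_triangle Linf_sum insert.prems) auto
  then show ?case
    using insert by auto
qed (auto intro!: Linf_norm_le Linf_zero)

section \<open>Bounded linear operators into the essentially bounded functions\<close>

lemma sup_norm_nonneg:
  assumes "S \<noteq> {}" "bdd_above ((\<lambda>z. \<bar>f z\<bar>) ` S)"
  shows "0 \<le> sup_norm S f"
proof -
  obtain z where "z \<in> S" using assms by auto
  then have "\<bar>f z\<bar> \<le> sup_norm S f"
    unfolding sup_norm_def by (rule cSUP_upper[OF _ assms(2)])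
  then show ?thesis by linarith
qed

lemma bdd_above_abs_image:
  fixes f :: "'b::topological_space \<Rightarrow> real"
  assumes "compact S" "continuous_on S f"
  shows "bdd_above ((\<lambda>z. \<bar>f z\<bar>) ` S)"
  using assms by (intro bounded_imp_bdd_above compact_imp_bounded compact_continuous_image continuous_on_rabs)

lemma abs_le_sup_norm:
  fixes f :: "'b::topological_space \<Rightarrow> real"
  assumes "compact S" "continuous_on S f" "z \<in> S"
  shows "\<bar>f z\<bar> \<le> sup_norm S f"
  unfolding sup_norm_def by (rule cSUP_upper[OF assms(3) bdd_above_abs_image[OF assms(1,2)]])

text \<open>The bound on the operator turns its almost-everywhere linearity into everything that the
  estimates use: finite additivity, independence of the values off \<open>\<partial>\<Omega> \<times> \<partial>\<Omega>\<close>, and the operator norm as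
  a Lipschitz constant. The frontier is nonempty so that suprema over it are not junk values.\<close>

locale boundary_operator =
  fixes \<Omega> :: "'a::euclidean_space set" and T :: "('a \<times> 'a \<Rightarrow> real) \<Rightarrow> 'a \<Rightarrow> real"
  assumes bounded: "bounded \<Omega>" and frontier_nonempty: "frontier \<Omega> \<noteq> {}"
    and bounded_linear: "bounded_linear_C_Linf \<Omega> T"
begin

lemma compact_bdry2: "compact (bdry2 \<Omega>)"
  using bounded by (intro compact_Times compact_frontier_bounded)

lemma bdry2_nonempty: "bdry2 \<Omega> \<noteq> {}"
  using frontier_nonempty by auto

lemma in_Linf: "continuous_on (bdry2 \<Omega>) f \<Longrightarrow> T f \<in> Linf \<Omega>"
  using bounded_linear by (simp add: bounded_linear_C_Linf_def)

lemma add: "continuous_on (bdry2 \<Omega>) f \<Longrightarrow> continuous_on (bdry2 \<Omega>) h \<Longrightarrow>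
    AE x in lebesgue_on \<Omega>. T (\<lambda>z. f z + h z) x = T f x + T h x"
  using bounded_linear by (simp add: bounded_linear_C_Linf_def)

lemma scale: "continuous_on (bdry2 \<Omega>) f \<Longrightarrow>
    AE x in lebesgue_on \<Omega>. T (\<lambda>z. c * f z) x = c * T f x"
  using bounded_linear by (simp add: bounded_linear_C_Linf_def)

text \<open>The supremum that defines the operator norm is a genuine one; a function of norm zero contributes
  the quotient \<open>0\<close>, and the bound of the operator applies to all others.\<close>

lemma bdd_above_quotients:
  "bdd_above ((\<lambda>f. Linf_norm \<Omega> (T f) / sup_norm (bdry2 \<Omega>) f) ` {f. continuous_on (bdry2 \<Omega>) f})"
proof -
  obtain B where B: "\<And>f. continuous_on (bdry2 \<Omega>) f \<Longrightarrow> Linf_norm \<Omega> (T f) \<le> B * sup_norm (bdry2 \<Omega>) f"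
    using bounded_linear by (auto simp: bounded_linear_C_Linf_def)
  have "Linf_norm \<Omega> (T f) / sup_norm (bdry2 \<Omega>) f \<le> \<bar>B\<bar>" if f: "continuous_on (bdry2 \<Omega>) f" for f
  proof (cases "sup_norm (bdry2 \<Omega>) f = 0")
    case False
    then have "sup_norm (bdry2 \<Omega>) f > 0"
      using sup_norm_nonneg[OF bdry2_nonempty bdd_above_abs_image[OF compact_bdry2 f]] by simp
    moreover have "Linf_norm \<Omega> (T f) \<le> \<bar>B\<bar> * sup_norm (bdry2 \<Omega>) f"
      using B[OF f] calculation by (meson abs_ge_self less_imp_le mult_right_mono order_trans)
    ultimately show ?thesis by (simp add: divide_le_eq)
  qed simp
  then show ?thesis by (auto simp: bdd_above_def)
qed

lemma norm_le_onorm: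
  assumes f: "continuous_on (bdry2 \<Omega>) f"
  shows "Linf_norm \<Omega> (T f) \<le> onorm_C_Linf \<Omega> T * sup_norm (bdry2 \<Omega>) f"
proof -
  have s0: "0 \<le> sup_norm (bdry2 \<Omega>) f"
    by (rule sup_norm_nonneg[OF bdry2_nonempty bdd_above_abs_image[OF compact_bdry2 f]])
  show ?thesis
  proof (cases "sup_norm (bdry2 \<Omega>) f = 0")
    case True
    then show ?thesis
      using bounded_linear f by (fastforce simp: bounded_linear_C_Linf_def)
  next
    case False
    have "Linf_norm \<Omega> (T f) / sup_norm (bdry2 \<Omega>) f \<le> onorm_C_Linf \<Omega> T"
      unfolding onorm_C_Linf_def by (rule cSUP_upper[OF _ bdd_above_quotients]) (use f in auto)
    then show ?thesis
      using False s0 by (simp add: divide_le_eq split: if_splits)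
  qed
qed

lemma onorm_nonneg: "0 \<le> onorm_C_Linf \<Omega> T"
proof -
  have "Linf_norm \<Omega> (T (\<lambda>_. 0)) / sup_norm (bdry2 \<Omega>) (\<lambda>_. 0) \<le> onorm_C_Linf \<Omega> T"
    unfolding onorm_C_Linf_def by (rule cSUP_upper[OF _ bdd_above_quotients]) auto
  moreover have "sup_norm (bdry2 \<Omega>) (\<lambda>_. 0) = 0"
    using bdry2_nonempty by (simp add: sup_norm_def)
  ultimately show ?thesis by simp
qed

lemma norm_le:
  assumes f: "continuous_on (bdry2 \<Omega>) f" and c: "\<And>z. z \<in> bdry2 \<Omega> \<Longrightarrow> \<bar>f z\<bar> \<le> c"
  shows "Linf_norm \<Omega> (T f) \<le> onorm_C_Linf \<Omega> T * c"
proof -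
  have "sup_norm (bdry2 \<Omega>) f \<le> c"
    unfolding sup_norm_def by (rule cSUP_least[OF bdry2_nonempty c])
  then show ?thesis
    using norm_le_onorm[OF f] onorm_nonneg by (meson mult_left_mono order_trans)
qed

lemma sum:
  "finite I \<Longrightarrow> (\<And>i. i \<in> I \<Longrightarrow> continuous_on (bdry2 \<Omega>) (f i)) \<Longrightarrow>
    AE x in lebesgue_on \<Omega>. T (\<lambda>z. \<Sum>i\<in>I. f i z) x = (\<Sum>i\<in>I. T (f i) x)"
proof (induction I rule: finite_induct)
  case empty
  show ?case using scale[of "\<lambda>_. 0" 0] by simp
next
  case (insert i I)
  have "AE x in lebesgue_on \<Omega>. T (\<lambda>z. f i z + (\<Sum>i\<in>I. f i z)) x = T (f i) x + T (\<lambda>z. \<Sum>i\<in>I. f i z) x"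
    by (intro add continuous_on_sum insert.prems) auto
  moreover have "AE x in lebesgue_on \<Omega>. T (\<lambda>z. \<Sum>i\<in>I. f i z) x = (\<Sum>i\<in>I. T (f i) x)"
    by (intro insert.IH insert.prems) auto
  ultimately show ?case
    by eventually_elim (use insert.hyps in auto)
qed

lemma diff:
  assumes "continuous_on (bdry2 \<Omega>) f" "continuous_on (bdry2 \<Omega>) h"
  shows "AE x in lebesgue_on \<Omega>. T (\<lambda>z. f z - h z) x = T f x - T h x"
proof -
  have "AE x in lebesgue_on \<Omega>. T (\<lambda>z. f z + (- 1) * h z) x = T f x + T (\<lambda>z. (- 1) * h z) x"
    by (intro add continuous_intros assms)
  then show ?thesis
    using scale[OF assms(2), of "- 1"] by eventually_elim simp
qed

text \<open>The difference of the two functions has sup norm \<open>0\<close> on \<open>\<partial>\<Omega> \<times> \<partial>\<Omega>\<close>, so its image is null.\<close>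

lemma cong_AE:
  assumes f: "continuous_on (bdry2 \<Omega>) f" and h: "continuous_on (bdry2 \<Omega>) h"
    and eq: "\<And>z. z \<in> bdry2 \<Omega> \<Longrightarrow> f z = h z"
  shows "AE x in lebesgue_on \<Omega>. T f x = T h x"
proof -
  have c: "continuous_on (bdry2 \<Omega>) (\<lambda>z. f z - h z)"
    by (intro continuous_intros f h)
  have "Linf_norm \<Omega> (T (\<lambda>z. f z - h z)) \<le> onorm_C_Linf \<Omega> T * 0"
    by (rule norm_le[OF c]) (use eq in auto)
  then have "AE x in lebesgue_on \<Omega>. T (\<lambda>z. f z - h z) x = 0"
    using AE_le_Linf_norm[OF in_Linf[OF c]] by (auto elim: eventually_mono)
  then show ?thesis
    using diff[OF f h] by eventually_elim simp
qed

end

section \<open>Weakly singular kernels\<close>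

text \<open>Dyadic shells: on \<open>R / 2^(j+1) < norm z \<le> R / 2^j\<close> the integrand is comparable to \<open>(R / 2^j)^\<gamma>\<close>, and
  the ball of radius \<open>R / 2^j\<close> has volume proportional to \<open>(R / 2^j)^d\<close>. The contributions decrease
  geometrically with ratio \<open>2^-(\<gamma> + d) < 1\<close>.\<close>

lemma integrable_norm_powr_cball:
  fixes \<gamma> R :: real
  assumes "\<gamma> > - real DIM('a)" and "R > 0"
  shows "integrable lborel (\<lambda>z::'a::euclidean_space. norm z powr \<gamma> * indicator (cball 0 R) z)"
proof (rule integrableI_nonneg)
  have "(\<lambda>z::'a. norm z powr \<gamma>) \<in> borel_measurable borel"
    by measurable
  then show "(\<lambda>z::'a. norm z powr \<gamma> * indicator (cball 0 R) z) \<in> borel_measurable lborel"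
    by (auto intro!: borel_measurable_times borel_measurable_indicator borel_closed)
  let ?d = "real DIM('a)"
  define V where "V = unit_ball_vol ?d"
  \<comment> \<open>The oscillation of \<open>norm z powr \<gamma>\<close> on a shell; the factor is \<open>1\<close> for positive exponents.\<close>
  define C where "C = max 1 (2 powr (- \<gamma>))"
  define r where "r j = R / 2 ^ j" for j :: nat
  have r0: "r j > 0" for j
    using \<open>R > 0\<close> by (simp add: r_def)
  have V0: "V \<ge> 0" by (simp add: V_def)
  have C0: "C \<ge> 1" by (simp add: C_def)
  have shell: "ennreal (norm z powr \<gamma> * indicator (cball 0 R) z)
      \<le> (\<Sum>j. ennreal (C * r j powr \<gamma>) * indicator (cball 0 (r j)) z)" for z :: 'a
  proof (cases "z = 0 \<or> norm z > R")
    case True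
    then show ?thesis by auto
  next
    case False
    then have z: "norm z > 0" "norm z \<le> R" by auto
    obtain n where "(1/2 :: real) ^ n < norm z / R"
      using real_arch_pow_inv[of "norm z / R" "1/2"] z \<open>R > 0\<close> by auto
    then have n: "norm z > r n"
      using \<open>R > 0\<close> by (simp add: r_def field_simps power_divide)
    define j where "j = (LEAST n. r (Suc n) < norm z)"
    have ex: "\<exists>n. r (Suc n) < norm z"
    proof
      have "r (Suc n) \<le> r n" using \<open>R > 0\<close> by (simp add: r_def field_simps)
      then show "r (Suc n) < norm z" using n by linarith
    qed
    have j1: "r (Suc j) < norm z"
      unfolding j_def by (rule LeastI_ex[OF ex])
    have j2: "norm z \<le> r j"
    proof (cases j)
      case 0
      then show ?thesis using z by (simp add: r_def)
    next
      case (Suc i)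
      then have "\<not> r (Suc i) < norm z"
        unfolding j_def by (metis lessI not_less_Least)
      then show ?thesis using Suc by simp
    qed
    have half: "r j / 2 \<le> norm z"
      using j1 by (simp add: r_def)
    have "norm z powr \<gamma> \<le> C * r j powr \<gamma>"
    proof (cases "\<gamma> \<ge> 0")
      case True
      have "norm z powr \<gamma> \<le> 1 * r j powr \<gamma>"
        using j2 True by (simp add: powr_mono2)
      also have "\<dots> \<le> C * r j powr \<gamma>"
        by (rule mult_right_mono) (use C0 in auto)
      finally show ?thesis .
    next
      case False
      have "norm z powr \<gamma> \<le> (r j / 2) powr \<gamma>"
        by (rule powr_mono2') (use False half r0[of j] in auto)
      also have "\<dots> = 2 powr (- \<gamma>) * r j powr \<gamma>"
        using r0[of j] by (simp add: powr_divide powr_minus divide_simps)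
      also have "\<dots> \<le> C * r j powr \<gamma>"
        by (rule mult_right_mono) (auto simp: C_def)
      finally show ?thesis .
    qed
    then have "ennreal (norm z powr \<gamma> * indicator (cball 0 R) z)
        \<le> ennreal (C * r j powr \<gamma>) * indicator (cball 0 (r j)) z"
      using z j2 by (simp add: ennreal_leI)
    also have "\<dots> \<le> (\<Sum>j. ennreal (C * r j powr \<gamma>) * indicator (cball 0 (r j)) z)"
      (is "?f j \<le> _")
    proof -
      have "sum ?f {j} \<le> suminf ?f"
        by (rule sum_le_suminf) auto
      then show ?thesis by (simp only: sum.insert sum.empty finite.emptyI empty_iff add_0_right simp_thms)
    qed
    finally show ?thesis .
  qed
  define \<theta> where "\<theta> = (1/2 :: real) powr (\<gamma> + ?d)"
  have \<theta>: "0 \<le> \<theta>" "\<theta> < 1"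
    using assms gr_one_powr[of 2 "\<gamma> + ?d"] by (auto simp: \<theta>_def powr_divide)
  have term_eq: "C * r j powr \<gamma> * (V * r j ^ DIM('a)) = C * V * R powr (\<gamma> + ?d) * \<theta> ^ j" for j
  proof -
    have "r j powr \<gamma> * r j ^ DIM('a) = r j powr (\<gamma> + ?d)"
      using r0[of j] by (simp add: powr_add powr_realpow)
    also have "\<dots> = (R * (1/2) powr real j) powr (\<gamma> + ?d)"
      by (simp add: r_def powr_realpow power_divide)
    also have "(R * (1/2) powr real j) powr (\<gamma> + ?d) = R powr (\<gamma> + ?d) * \<theta> ^ j"
      using \<open>R > 0\<close> by (simp add: powr_mult powr_powr \<theta>_def powr_realpow[symmetric] mult.commute del: powr_realpow)
    finally show ?thesis by (simp add: mult_ac)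
  qed
  have "(\<integral>\<^sup>+z. ennreal (norm (z::'a) powr \<gamma> * indicator (cball 0 R) z) \<partial>lborel)
      \<le> (\<integral>\<^sup>+z. (\<Sum>j. ennreal (C * r j powr \<gamma>) * indicator (cball 0 (r j)) z) \<partial>(lborel :: 'a measure))"
    by (rule nn_integral_mono) (rule shell)
  also have "\<dots> = (\<Sum>j. \<integral>\<^sup>+z. ennreal (C * r j powr \<gamma>) * indicator (cball 0 (r j)) z \<partial>(lborel :: 'a measure))"
    by (rule nn_integral_suminf, rule borel_measurable_times_ennreal)
       (auto intro!: borel_measurable_indicator borel_closed)
  also have "\<dots> = (\<Sum>j. ennreal (C * V * R powr (\<gamma> + ?d) * \<theta> ^ j))"
  proof (rule suminf_cong)
    fix j
    have "(\<integral>\<^sup>+z. ennreal (C * r j powr \<gamma>) * indicator (cball 0 (r j)) z \<partial>(lborel :: 'a measure))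
        = ennreal (C * r j powr \<gamma>) * ennreal (V * r j ^ DIM('a))"
      using emeasure_cball[of "r j" "0 :: 'a"] r0[of j] by (simp add: nn_integral_cmult_indicator V_def)
    also have "\<dots> = ennreal (C * r j powr \<gamma> * (V * r j ^ DIM('a)))"
      using C0 V0 r0[of j] by (subst ennreal_mult) auto
    finally show "(\<integral>\<^sup>+z. ennreal (C * r j powr \<gamma>) * indicator (cball 0 (r j)) z \<partial>(lborel :: 'a measure))
        = ennreal (C * V * R powr (\<gamma> + ?d) * \<theta> ^ j)"
      by (simp only: term_eq)
  qed
  also have "\<dots> < \<infinity>"
    using \<theta> C0 V0
    by (subst suminf_ennreal2) (auto intro!: summable_mult summable_geometric mult_nonneg_nonneg)
  finally show "(\<integral>\<^sup>+z. ennreal (norm (z::'a) powr \<gamma> * indicator (cball 0 R) z) \<partial>lborel) < \<infinity>" .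
qed auto

definition off_diagonal :: "'a::euclidean_space set \<Rightarrow> ('a \<times> 'a) set" where
  "off_diagonal \<Omega> = {(x, y). x \<in> closure \<Omega> \<and> y \<in> \<Omega> \<and> x \<noteq> y}"

text \<open>The estimates need only that the kernel is continuous off the diagonal and dominated by a
  translate of one integrable function, which bounds the integrals over \<open>y\<close> uniformly in \<open>x\<close>.\<close>

locale singular_kernel =
  fixes \<Omega> :: "'a::euclidean_space set" and H :: "'a \<Rightarrow> 'a \<Rightarrow> real" and w :: "'a \<Rightarrow> real"
  assumes open_domain: "open \<Omega>" and bounded_domain: "bounded \<Omega>"
    and H_cont: "continuous_on (off_diagonal \<Omega>) (\<lambda>(x, y). H x y)"
    and w_int: "integrable lborel w"
    and w_nonneg: "\<And>z. 0 \<le> w z"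
    and H_le: "\<And>x y. x \<in> closure \<Omega> \<Longrightarrow> y \<in> \<Omega> \<Longrightarrow> x \<noteq> y \<Longrightarrow> \<bar>H x y\<bar> \<le> w (y - x)"

lemma weakly_singular_imp_singular_kernel:
  fixes \<Omega> :: "'a::euclidean_space set"
  assumes "open \<Omega>" "bounded \<Omega>" "weakly_singular \<Omega> G"
  shows "\<exists>w. singular_kernel \<Omega> G w"
proof -
  obtain \<alpha> M where \<alpha>: "\<alpha> > 0"
    and G: "\<And>x y. x \<in> closure \<Omega> \<Longrightarrow> y \<in> \<Omega> \<Longrightarrow> x \<noteq> y \<Longrightarrow> \<bar>G x y\<bar> \<le> M * dist x y powr (\<alpha> - real DIM('a))"
    using assms(3) by (auto simp: weakly_singular_def)
  have "bounded (closure \<Omega>)" using assms by (simp add: bounded_closure)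
  then obtain R where R: "R > 0" "\<And>x. x \<in> closure \<Omega> \<Longrightarrow> norm x \<le> R"
    using bounded_pos by blast
  define w where "w z = \<bar>M\<bar> * (norm z powr (\<alpha> - real DIM('a)) * indicator (cball 0 (2 * R)) z)" for z :: 'a
  have "singular_kernel \<Omega> G w"
  proof
    show "continuous_on (off_diagonal \<Omega>) (\<lambda>(x, y). G x y)"
      using assms(3) by (simp add: weakly_singular_def off_diagonal_def)
    show "integrable lborel w"
      unfolding w_def by (intro integrable_mult_right integrable_norm_powr_cball) (use \<alpha> R in auto)
    fix x y assume *: "x \<in> closure \<Omega>" "y \<in> \<Omega>" "x \<noteq> y"
    have "norm (y - x) \<le> 2 * R"
      using R(2)[OF *(1)] R(2)[of y] *(2) closure_subset[of \<Omega>] norm_triangle_ineq4[of y x] by fastforce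
    moreover have "M * dist x y powr (\<alpha> - real DIM('a)) \<le> \<bar>M\<bar> * dist x y powr (\<alpha> - real DIM('a))"
      by (rule mult_right_mono) auto
    ultimately show "\<bar>G x y\<bar> \<le> w (y - x)"
      using G[OF *] by (simp add: w_def dist_norm norm_minus_commute)
  qed (use assms in \<open>auto simp: w_def\<close>)
  then show "\<exists>w. singular_kernel \<Omega> G w" by blast
qed

lemma lebesgue_on_nn_integral_translate_le:
  fixes w :: "'a::euclidean_space \<Rightarrow> ennreal"
  assumes [measurable]: "w \<in> borel_measurable borel" and "S \<in> sets lebesgue"
  shows "(\<integral>\<^sup>+y. w (y - x) \<partial>lebesgue_on S) \<le> (\<integral>\<^sup>+z. w z \<partial>lborel)"
proof -
  have "(\<integral>\<^sup>+y. w (y - x) \<partial>lebesgue_on S) = (\<integral>\<^sup>+y. w (y - x) * indicator S y \<partial>lebesgue)"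
    using assms by (subst nn_integral_restrict_space) auto
  also have "\<dots> \<le> (\<integral>\<^sup>+y. w (y - x) \<partial>lebesgue)"
    by (rule nn_integral_mono) (auto simp: indicator_def)
  also have "\<dots> = (\<integral>\<^sup>+y. w (y - x) \<partial>lborel)"
    by (rule nn_integral_completion)
  also have "\<dots> = (\<integral>\<^sup>+y. w (y - x) \<partial>distr lborel borel ((+) x))"
    by (simp add: lborel_distr_plus)
  also have "\<dots> = (\<integral>\<^sup>+z. w z \<partial>lborel)"
    by (subst nn_integral_distr) auto
  finally show ?thesis .
qed


lemma closure_section_measurable:
  assumes "open \<Omega>" "continuous_on (closure \<Omega> \<times> S) v" "s \<in> S"
  shows "(\<lambda>y. v (y, s)) \<in> borel_measurable (lebesgue_on \<Omega>)"
proof (rule continuous_imp_measurable_on_sets_lebesgue)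
  have "continuous_on \<Omega> (v \<circ> (\<lambda>y. (y, s)))"
    by (intro continuous_on_compose continuous_intros continuous_on_subset[OF assms(2)])
       (use assms closure_subset in auto)
  then show "continuous_on \<Omega> (\<lambda>y. v (y, s))" by (simp add: o_def)
qed (use assms in auto)

context singular_kernel begin

lemma domain_lebesgue: "\<Omega> \<in> sets lebesgue"
  using open_domain by auto

lemma finite_measure_domain: "finite_measure (lebesgue_on \<Omega>)"
  by (rule finite_measure_lebesgue_on) (use open_domain bounded_domain in \<open>simp add: lmeasurable_open\<close>)

lemma AE_off_diagonal: "AE y in lebesgue_on \<Omega>. y \<noteq> x"
proof -
  have "AE y in lebesgue. y \<noteq> x"
    by (rule AE_completion) (rule AE_lborel_singleton)
  then show ?thesis
    using domain_lebesgue by (auto simp: AE_restrict_space_iff elim: eventually_mono)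
qed

text \<open>Continuity off the diagonal leaves one value of \<open>H x\<close> uncontrolled, and one point is measurable.\<close>

lemma kernel_measurable:
  assumes x: "x \<in> closure \<Omega>"
  shows "H x \<in> borel_measurable (lebesgue_on \<Omega>)"
proof -
  have cont: "continuous_on (\<Omega> - {x}) (H x)"
  proof -
    have "continuous_on (\<Omega> - {x}) ((\<lambda>(x, y). H x y) \<circ> (\<lambda>y. (x, y)))"
      by (intro continuous_on_compose continuous_intros continuous_on_subset[OF H_cont])
         (use x in \<open>auto simp: off_diagonal_def\<close>)
    then show ?thesis by (simp add: o_def)
  qed
  have S: "\<Omega> - {x} \<in> sets lebesgue"
    using open_domain by (intro borel_open[THEN sets_completionI_sets[of _ lborel, simplified]]) auto
  have "(\<lambda>y. if y \<in> \<Omega> - {x} then H x y else 0) \<in> borel_measurable lebesgue"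
    using continuous_imp_measurable_on_sets_lebesgue[OF cont S] borel_measurable_if[OF S] by blast
  moreover have "(\<lambda>y. if y \<in> \<Omega> \<inter> {x} then H x x else 0) \<in> borel_measurable lebesgue"
    by (rule measurable_If_set) (use domain_lebesgue in auto)
  ultimately have "(\<lambda>y. (if y \<in> \<Omega> - {x} then H x y else 0) + (if y \<in> \<Omega> \<inter> {x} then H x x else 0))
      \<in> borel_measurable lebesgue"
    by (rule borel_measurable_add)
  also have "(\<lambda>y. (if y \<in> \<Omega> - {x} then H x y else 0) + (if y \<in> \<Omega> \<inter> {x} then H x x else 0))
      = (\<lambda>y. if y \<in> \<Omega> then H x y else 0)"
    by auto
  finally show ?thesis
    using borel_measurable_if[OF domain_lebesgue] by blast
qed

lemma majorant_measurable: "(\<lambda>y. w (y - x)) \<in> borel_measurable (lebesgue_on \<Omega>)"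
proof -
  have [measurable]: "w \<in> borel_measurable borel"
    using w_int by (simp add: borel_measurable_integrable)
  have "(\<lambda>y. w (y - x)) \<in> borel_measurable borel"
    by measurable
  then show ?thesis
    by (simp add: measurable_completion measurable_restrict_space1)
qed

lemma majorant_integrable: "integrable (lebesgue_on \<Omega>) (\<lambda>y. w (y - x))"
proof (rule integrableI_nonneg)
  have [measurable]: "w \<in> borel_measurable borel"
    using w_int by (simp add: borel_measurable_integrable)
  have "(\<integral>\<^sup>+y. ennreal (w (y - x)) \<partial>lebesgue_on \<Omega>) \<le> (\<integral>\<^sup>+z. ennreal (w z) \<partial>lborel)"
    by (rule lebesgue_on_nn_integral_translate_le) (use domain_lebesgue in auto)
  also have "\<dots> < \<infinity>"
    using w_int w_nonneg by (simp add: integrable_iff_bounded)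
  finally show "(\<integral>\<^sup>+y. ennreal (w (y - x)) \<partial>lebesgue_on \<Omega>) < \<infinity>" .
qed (auto simp: w_nonneg majorant_measurable)

lemma kernel_AE_le:
  assumes x: "x \<in> closure \<Omega>"
  shows "AE y in lebesgue_on \<Omega>. \<bar>H x y\<bar> \<le> w (y - x)"
  using AE_off_diagonal[of x] AE_space by eventually_elim (use H_le[OF x] in auto)

lemma kernel_mult_integrable:
  assumes x: "x \<in> closure \<Omega>" and [measurable]: "q \<in> borel_measurable (lebesgue_on \<Omega>)"
    and q: "AE y in lebesgue_on \<Omega>. \<bar>q y\<bar> \<le> c"
  shows "integrable (lebesgue_on \<Omega>) (\<lambda>y. H x y * q y)"
proof (rule Bochner_Integration.integrable_bound)
  show "integrable (lebesgue_on \<Omega>) (\<lambda>y. w (y - x) * c)"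
    by (intro integrable_mult_left majorant_integrable)
  show "AE y in lebesgue_on \<Omega>. norm (H x y * q y) \<le> norm (w (y - x) * c)"
    using kernel_AE_le[OF x] q
  proof eventually_elim
    case (elim y)
    have "\<bar>H x y\<bar> * \<bar>q y\<bar> \<le> w (y - x) * c"
      by (rule mult_mono) (use elim w_nonneg in auto)
    then show ?case
      using abs_ge_self[of "w (y - x) * c"] by (simp add: abs_mult[symmetric])
  qed
  show "(\<lambda>y. H x y * q y) \<in> borel_measurable (lebesgue_on \<Omega>)"
    using kernel_measurable[OF x] by measurable
qed

lemma kernel_integrable: "x \<in> closure \<Omega> \<Longrightarrow> integrable (lebesgue_on \<Omega>) (H x)"
  using kernel_mult_integrable[of x "\<lambda>_. 1" 1] by simp

text \<open>The mass of the majorant above height \<open>j\<close> bounds the error of cutting the kernel off at height \<open>j\<close>.\<close>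

lemma truncated_excess_tendsto_0:
  "(\<lambda>j. \<integral>z. max 0 (w z - real j) \<partial>lborel) \<longlonglongrightarrow> 0"
proof -
  have [measurable]: "w \<in> borel_measurable borel"
    using w_int by (simp add: borel_measurable_integrable)
  have "(\<lambda>j. \<integral>z. max 0 (w z - real j) \<partial>lborel) \<longlonglongrightarrow> (\<integral>z. 0 \<partial>(lborel :: 'a measure))"
  proof (rule integral_dominated_convergence[where w = w])
    show "AE z in lborel. (\<lambda>j. max 0 (w z - real j)) \<longlonglongrightarrow> 0"
    proof (intro AE_I2 tendsto_eventually)
      fix z
      obtain n where n: "w z < real n" using reals_Archimedean2 by blast
      show "\<forall>\<^sub>F j in sequentially. max 0 (w z - real j) = 0"
        using eventually_ge_at_top[of n] by eventually_elim (use n in auto)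
    qed
    show "AE z in lborel. norm (max 0 (w z - real j)) \<le> w z" for j
      using w_nonneg by (intro AE_I2) auto
  qed (auto intro: w_int)
  then show ?thesis by simp
qed

text \<open>Cut the kernel off at height \<open>j\<close>. A bounded kernel gives a continuous function by dominated
  convergence, because for fixed \<open>x\<close> all points \<open>y \<noteq> x\<close> are points of continuity. The error of the cut-off
  is at most the excess mass of the majorant, whatever \<open>x\<close> is, because Lebesgue measure is translation
  invariant; so the continuous approximations converge uniformly.\<close>

lemma continuous_integral_operator:
  fixes v :: "'a \<times> 's::euclidean_space \<Rightarrow> real"
  assumes S: "compact S" and v: "continuous_on (closure \<Omega> \<times> S) v"
    and [measurable]: "q \<in> borel_measurable (lebesgue_on \<Omega>)"
    and q: "AE y in lebesgue_on \<Omega>. \<bar>q y\<bar> \<le> c"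
  shows "continuous_on (closure \<Omega> \<times> S) (\<lambda>(x, s). LINT y|lebesgue_on \<Omega>. H x y * q y * v (y, s))"
proof -
  let ?Z = "closure \<Omega> \<times> S" and ?M = "lebesgue_on \<Omega>"
  interpret finite_measure ?M by (rule finite_measure_domain)
  have "compact ?Z"
    using bounded_domain S by (intro compact_Times) (auto simp: compact_closure)
  then have "bounded (v ` ?Z)"
    using v by (intro compact_imp_bounded compact_continuous_image)
  then obtain V where V: "V > 0" "\<And>z. z \<in> ?Z \<Longrightarrow> \<bar>v z\<bar> \<le> V"
    unfolding bounded_pos by (metis image_eqI real_norm_def)
  define D where "D = max c 0 * V"
  have D0: "0 \<le> D" using V by (simp add: D_def)
  have v_meas: "(\<lambda>y. v (y, s)) \<in> borel_measurable ?M" if "s \<in> S" for s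
    by (rule closure_section_measurable[OF open_domain v that])
  have density_le: "AE y in ?M. \<forall>s\<in>S. \<bar>q y * v (y, s)\<bar> \<le> D"
    using q AE_space
  proof eventually_elim
    case (elim y)
    then have "y \<in> closure \<Omega>" using closure_subset by auto
    then have "\<bar>q y\<bar> * \<bar>v (y, s)\<bar> \<le> max c 0 * V" if "s \<in> S" for s
      by (intro mult_mono) (use elim V(2)[of "(y, s)"] V(1) that in auto)
    then show ?case by (simp add: D_def abs_mult)
  qed
  define cut where "cut j a = max (- real j) (min (real j) a)" for j and a :: real
  define F where "F = (\<lambda>(x, s). LINT y|?M. H x y * q y * v (y, s))"
  define Fj where "Fj j = (\<lambda>(x, s). LINT y|?M. cut j (H x y) * q y * v (y, s))" for j
  have cut_meas: "(\<lambda>y. cut j (H x y)) \<in> borel_measurable ?M" if "x \<in> closure \<Omega>" for x j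
    unfolding cut_def using kernel_measurable[OF that] by measurable
  have cut_le: "\<bar>cut j a\<bar> \<le> real j" for j a
    by (auto simp: cut_def)
  have meas_j: "(\<lambda>y. cut j (H x y) * q y * v (y, s)) \<in> borel_measurable ?M"
    if "x \<in> closure \<Omega>" "s \<in> S" for x s j
    using cut_meas[OF that(1)] v_meas[OF that(2)] by measurable
  have le_j: "AE y in ?M. \<bar>cut j (H x y) * q y * v (y, s)\<bar> \<le> real j * D" if "s \<in> S" for x s j
    using density_le
  proof eventually_elim
    case (elim y)
    have "\<bar>cut j (H x y)\<bar> * \<bar>q y * v (y, s)\<bar> \<le> real j * D"
      by (rule mult_mono) (use elim that cut_le in auto)
    then show ?case by (simp add: abs_mult mult.assoc)
  qed
  have cont_j: "continuous_on ?Z (Fj j)" for j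
    unfolding continuous_on_sequentially
  proof (intro allI ballI impI)
    fix X a assume a: "a \<in> ?Z" and X: "(\<forall>n. X n \<in> ?Z) \<and> X \<longlonglongrightarrow> a"
    obtain x s where xs: "a = (x, s)" "x \<in> closure \<Omega>" "s \<in> S" using a by auto
    define xn where "xn n = fst (X n)" for n
    define sn where "sn n = snd (X n)" for n
    have Xn: "X n = (xn n, sn n)" "xn n \<in> closure \<Omega>" "sn n \<in> S" for n
      using X by (auto simp: xn_def sn_def mem_Times_iff)
    have lim: "xn \<longlonglongrightarrow> x" "sn \<longlonglongrightarrow> s"
      using X tendsto_fst[of X a sequentially] tendsto_snd[of X a sequentially]
      by (simp_all add: xn_def[abs_def] sn_def[abs_def] xs)
    have "(\<lambda>n. LINT y|?M. cut j (H (xn n) y) * q y * v (y, sn n))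
        \<longlonglongrightarrow> (LINT y|?M. cut j (H x y) * q y * v (y, s))"
    proof (rule integral_dominated_convergence[where w = "\<lambda>_. real j * D"])
      show "AE y in ?M. (\<lambda>n. cut j (H (xn n) y) * q y * v (y, sn n)) \<longlonglongrightarrow> cut j (H x y) * q y * v (y, s)"
        using AE_off_diagonal[of x] AE_space
      proof eventually_elim
        case (elim y)
        then have y: "y \<in> \<Omega>" "y \<in> closure \<Omega>" "x \<noteq> y" using closure_subset by auto
        have "(\<lambda>n. (xn n, y)) \<longlonglongrightarrow> (x, y)"
          by (intro tendsto_intros lim)
        moreover have "\<forall>\<^sub>F n in sequentially. xn n \<noteq> y"
          using lim(1) y(3) by (rule tendsto_imp_eventually_ne)
        then have "\<forall>\<^sub>F n in sequentially. (xn n, y) \<in> off_diagonal \<Omega>"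
          by eventually_elim (use y Xn in \<open>auto simp: off_diagonal_def\<close>)
        ultimately have "(\<lambda>n. H (xn n) y) \<longlonglongrightarrow> H x y"
          using continuous_on_tendsto_compose[OF H_cont, of "\<lambda>n. (xn n, y)" "(x, y)" sequentially] y xs
          by (simp add: off_diagonal_def)
        moreover have "(\<lambda>n. v (y, sn n)) \<longlonglongrightarrow> v (y, s)"
        proof (rule continuous_on_tendsto_compose[OF v])
          show "(\<lambda>n. (y, sn n)) \<longlonglongrightarrow> (y, s)"
            by (intro tendsto_Pair tendsto_const lim)
        qed (use y xs Xn in auto)
        ultimately show ?case
          unfolding cut_def by (intro tendsto_intros)
      qed
      show "AE y in ?M. norm (cut j (H (xn n) y) * q y * v (y, sn n)) \<le> real j * D" for n
        using le_j[OF Xn(3)] by simp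
    qed (use meas_j xs Xn in auto)
    then show "(Fj j \<circ> X) \<longlonglongrightarrow> Fj j a"
      by (simp add: Fj_def o_def Xn xs)
  qed
  define e where "e j = (\<integral>z. max 0 (w z - real j) \<partial>lborel)" for j
  have [measurable]: "w \<in> borel_measurable borel"
    using w_int by (simp add: borel_measurable_integrable)
  have e0: "0 \<le> e j" for j
    by (simp add: e_def)
  have e_int: "integrable lborel (\<lambda>z. max 0 (w z - real j))" for j
    by (rule Bochner_Integration.integrable_bound[OF w_int]) (use w_nonneg in auto)
  have dist_le: "dist (Fj j z) (F z) \<le> D * e j" if z: "z \<in> ?Z" for z j
  proof -
    obtain x s where xs: "z = (x, s)" "x \<in> closure \<Omega>" "s \<in> S" using z by auto
    have int1: "integrable ?M (\<lambda>y. cut j (H x y) * q y * v (y, s))"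
      by (rule integrable_const_bound[OF _ meas_j]) (use le_j[OF xs(3)] xs in auto)
    have int2: "integrable ?M (\<lambda>y. H x y * (q y * v (y, s)))"
      by (rule kernel_mult_integrable[where c = D])
         (use xs v_meas[OF xs(3)] density_le in \<open>auto elim: eventually_mono\<close>)
    have "F z - Fj j z = (LINT y|?M. H x y * q y * v (y, s) - cut j (H x y) * q y * v (y, s))"
      using int1 int2 by (simp add: F_def Fj_def xs mult.assoc)
    also have "\<bar>\<dots>\<bar> \<le> (LINT y|?M. \<bar>H x y * q y * v (y, s) - cut j (H x y) * q y * v (y, s)\<bar>)"
      by (rule integral_abs_bound)
    also have "ennreal \<dots> = (\<integral>\<^sup>+y. ennreal \<bar>H x y * q y * v (y, s) - cut j (H x y) * q y * v (y, s)\<bar> \<partial>?M)"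
      using int1 int2 by (intro nn_integral_eq_integral[symmetric]) (auto simp: mult.assoc)
    also have "\<dots> \<le> (\<integral>\<^sup>+y. ennreal (D * max 0 (w (y - x) - real j)) \<partial>?M)"
    proof (rule nn_integral_mono_AE)
      show "AE y in ?M. ennreal \<bar>H x y * q y * v (y, s) - cut j (H x y) * q y * v (y, s)\<bar>
          \<le> ennreal (D * max 0 (w (y - x) - real j))"
        using kernel_AE_le[OF xs(2)] density_le
      proof eventually_elim
        case (elim y)
        have "\<bar>H x y - cut j (H x y)\<bar> \<le> max 0 (w (y - x) - real j)"
          using elim(1) by (auto simp: cut_def)
        then have "\<bar>H x y - cut j (H x y)\<bar> * \<bar>q y * v (y, s)\<bar> \<le> max 0 (w (y - x) - real j) * D"
          by (rule mult_mono) (use elim(2) xs D0 in auto)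
        then show ?case
          by (intro ennreal_leI) (simp add: abs_mult[symmetric] algebra_simps)
      qed
    qed
    also have "\<dots> \<le> (\<integral>\<^sup>+z. ennreal (D * max 0 (w z - real j)) \<partial>lborel)"
      by (rule lebesgue_on_nn_integral_translate_le) (use domain_lebesgue in auto)
    also have "\<dots> = ennreal (D * e j)"
      unfolding e_def using e_int D0 by (subst nn_integral_eq_integral) (auto intro: integrable_mult_right)
    finally have "ennreal \<bar>F z - Fj j z\<bar> \<le> ennreal (D * e j)"
      by (simp add: ennreal_leI)
    then show ?thesis
      using D0 e0 by (simp add: dist_real_def abs_minus_commute)
  qed
  have "uniform_limit ?Z Fj F sequentially"
  proof (rule uniform_limitI)
    fix \<epsilon> :: real assume "\<epsilon> > 0"
    have "(\<lambda>j. D * e j) \<longlonglongrightarrow> D * 0"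
      unfolding e_def by (intro tendsto_intros truncated_excess_tendsto_0)
    then have "\<forall>\<^sub>F j in sequentially. D * e j < \<epsilon>"
      using \<open>\<epsilon> > 0\<close> by (intro order_tendstoD) auto
    then show "\<forall>\<^sub>F j in sequentially. \<forall>z\<in>?Z. dist (Fj j z) (F z) < \<epsilon>"
      by eventually_elim (use dist_le in \<open>fastforce intro: le_less_trans\<close>)
  qed
  then have "continuous_on ?Z F"
    by (rule uniform_limit_theorem[rotated]) (auto intro: cont_j always_eventually)
  then show ?thesis by (simp add: F_def)
qed

lemma abs_kernel: "singular_kernel \<Omega> (\<lambda>x y. \<bar>H x y\<bar>) w"
proof
  show "continuous_on (off_diagonal \<Omega>) (\<lambda>(x, y). \<bar>H x y\<bar>)"
    using continuous_on_rabs[OF H_cont] by (simp add: case_prod_unfold)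
qed (use open_domain bounded_domain w_int w_nonneg H_le in auto)

text \<open>The constant \<open>\<mu>\<close> is a supremum over \<open>\<Omega>\<close>, whereas the data are taken on \<open>\<partial>\<Omega>\<close>. Continuity up to
  the boundary extends the bound to the closure, and compactness makes the supremum finite.\<close>

lemma integral_abs_kernel_le:
  assumes x: "x \<in> closure \<Omega>"
  shows "(LINT y|lebesgue_on \<Omega>. \<bar>H x y\<bar>) \<le> (SUP x\<in>\<Omega>. LINT y|lebesgue_on \<Omega>. \<bar>H x y\<bar>)"
proof -
  interpret abs: singular_kernel \<Omega> "\<lambda>x y. \<bar>H x y\<bar>" w by (rule abs_kernel)
  define f where "f x = (LINT y|lebesgue_on \<Omega>. \<bar>H x y\<bar>)" for x
  \<comment> \<open>A one-point parameter set makes the integral a function of \<open>x\<close> alone.\<close>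
  have "continuous_on (closure \<Omega> \<times> {0::real}) (\<lambda>(x, s). LINT y|lebesgue_on \<Omega>. \<bar>H x y\<bar> * 1 * 1)"
    by (rule abs.continuous_integral_operator[where c = 1]) auto
  then have "continuous_on (closure \<Omega>) ((\<lambda>(x, s). LINT y|lebesgue_on \<Omega>. \<bar>H x y\<bar> * 1 * 1) \<circ> (\<lambda>x. (x, 0::real)))"
    by (intro continuous_on_compose continuous_intros) (auto elim: continuous_on_subset)
  then have cont: "continuous_on (closure \<Omega>) f"
    by (simp add: f_def o_def)
  have "compact (closure \<Omega>)" using bounded_domain by (simp add: compact_closure)
  then have "bdd_above (f ` closure \<Omega>)"
    by (intro bounded_imp_bdd_above compact_imp_bounded compact_continuous_image cont)
  then have "bdd_above (f ` \<Omega>)"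
    by (rule bdd_above_mono) (use closure_subset in auto)
  then have "f x \<le> (SUP x\<in>\<Omega>. f x)"
    by (intro continuous_le_on_closure[OF cont x]) (auto intro: cSUP_upper)
  then show ?thesis by (simp add: f_def)
qed

end

section \<open>Ternary trees and geometric sums\<close>

text \<open>The number of ternary trees with \<open>n\<close> nodes, which is \<open>(3n choose n) / (2n + 1)\<close>. The cubic nonlinearity
  makes the norms of the forward operators obey this recursion.\<close>

fun ternary_trees :: "nat \<Rightarrow> real" where
  "ternary_trees 0 = 1"
| "ternary_trees (Suc n) = (\<Sum>(i, j, l)\<in>{(i, j, l). i + j + l = n}.
     ternary_trees i * ternary_trees j * ternary_trees l)"

lemma finite_triples: "finite {(i, j, l). i + j + l = (n::nat)}"
  by (rule finite_subset[of _ "{..n} \<times> {..n} \<times> {..n}"]) auto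

lemma ternary_trees_nonneg: "0 \<le> ternary_trees n"
proof (induction n rule: less_induct)
  case (less n)
  show ?case
  proof (cases n)
    case (Suc m)
    then show ?thesis
      by (auto intro!: sum_nonneg mult_nonneg_nonneg less.IH)
  qed simp
qed

text \<open>The generating function solves \<open>A = 1 + t A^3\<close>, and \<open>t = 4/27\<close> is the largest \<open>t\<close> for which this cubic has
  a positive root, namely \<open>A = 3/2\<close>. The partial sums \<open>S\<close> of the series satisfy
  \<open>S (m+1) \<le> 1 + t (S m)^3\<close>, so they never pass that root.\<close>

lemma sum_ternary_trees_le: "(\<Sum>n\<le>m. ternary_trees n * (4/27)^n) \<le> 3/2"
proof (induction m)
  case 0
  show ?case by simp
next
  case (Suc m)
  define t where "t n = ternary_trees n * (4/27)^n" for n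
  define S where "S = (\<Sum>n\<le>m. t n)"
  have t0: "t n \<ge> 0" for n
    by (simp add: t_def ternary_trees_nonneg)
  have S: "0 \<le> S" "S \<le> 3/2"
    using Suc t0 by (auto simp: S_def t_def[symmetric] intro: sum_nonneg)
  have step: "t (Suc n) = 4/27 * (\<Sum>(i, j, l)\<in>{(i, j, l). i + j + l = n}. t i * t j * t l)" for n
    by (auto simp: t_def sum_distrib_left sum_distrib_right power_add[symmetric] intro!: sum.cong)
       (auto simp: power_add)
  have "(\<Sum>n\<le>m. \<Sum>(i, j, l)\<in>{(i, j, l). i + j + l = n}. t i * t j * t l)
      = (\<Sum>(n, i, j, l)\<in>(SIGMA n:{..m}. {(i, j, l). i + j + l = n}). t i * t j * t l)"
    by (subst sum.Sigma) (auto simp: finite_triples)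
  also have "\<dots> = (\<Sum>(i, j, l)\<in>{(i, j, l). i + j + l \<le> m}. t i * t j * t l)"
    by (rule sum.reindex_bij_witness[of _ "\<lambda>(i, j, l). (i + j + l, i, j, l)" snd]) auto
  also have "\<dots> \<le> (\<Sum>(i, j, l)\<in>{..m} \<times> {..m} \<times> {..m}. t i * t j * t l)"
    by (rule sum_mono2) (auto simp: t0)
  also have "\<dots> = (\<Sum>i\<le>m. \<Sum>j\<le>m. \<Sum>l\<le>m. t i * t j * t l)"
    by (simp add: sum.cartesian_product)
  also have "\<dots> = S ^ 3"
    by (simp add: S_def power3_eq_cube sum_distrib_left[symmetric] sum_distrib_right[symmetric])
  also have "\<dots> \<le> (3/2) ^ 3"
    by (rule power_mono) (use S in auto)
  finally have "(\<Sum>n\<le>m. t (Suc n)) \<le> 4/27 * (3/2)^3"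
    unfolding step sum_distrib_left[symmetric] by simp
  moreover have "(\<Sum>n\<le>Suc m. t n) = 1 + (\<Sum>n\<le>m. t (Suc n))"
    by (subst sum.atMost_Suc_shift) (simp add: t_def)
  ultimately show ?case
    by (simp add: t_def power3_eq_cube)
qed

lemma ternary_trees_le: "ternary_trees n \<le> 3/2 * (27/4)^n"
proof -
  have "ternary_trees n * (4/27)^n \<le> (\<Sum>k\<le>n. ternary_trees k * (4/27)^k)"
    by (rule member_le_sum) (auto simp: ternary_trees_nonneg)
  also have "\<dots> \<le> 3/2"
    by (rule sum_ternary_trees_le)
  finally show ?thesis
    by (simp add: power_divide field_simps)
qed

lemma sum_prod_list_eq_power:
  fixes f :: "'a \<Rightarrow> 'b::comm_semiring_1"
  assumes "finite A"
  shows "(\<Sum>xs | set xs \<subseteq> A \<and> length xs = n. prod_list (map f xs)) = (\<Sum>x\<in>A. f x) ^ n"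
proof (induction n)
  case 0
  have "{xs. set xs \<subseteq> A \<and> length xs = 0} = {[]}" by auto
  then show ?case by simp
next
  case (Suc n)
  have "(\<Sum>xs | set xs \<subseteq> A \<and> length xs = Suc n. prod_list (map f xs))
      = (\<Sum>(xs, x)\<in>{xs. set xs \<subseteq> A \<and> length xs = n} \<times> A. f x * prod_list (map f xs))"
    unfolding lists_length_Suc_eq by (subst sum.reindex) (auto simp: inj_on_def case_prod_unfold)
  also have "\<dots> = (\<Sum>xs | set xs \<subseteq> A \<and> length xs = n. prod_list (map f xs)) * (\<Sum>x\<in>A. f x)"
    unfolding sum_product sum.cartesian_product by (simp add: mult.commute)
  finally show ?case
    using Suc by (simp add: mult.commute)
qed

lemma sum_Suc_power_le:
  fixes q :: real
  assumes "0 \<le> q" "q < 1"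
  shows "(\<Sum>n = 2..m. real n * q ^ (n - 1)) \<le> 1 / (1 - q)\<^sup>2 - 1"
proof -
  have sums: "(\<lambda>n. real (Suc n) * q ^ n) sums (1 / (1 - q)\<^sup>2)"
    using geometric_deriv_sums[of q] assms by simp
  have "1 + (\<Sum>n = 2..m. real n * q ^ (n - 1)) = 1 + (\<Sum>n = 1..<m. real (Suc n) * q ^ n)"
    by (intro arg_cong2[where f = "(+)"] refl
        sum.reindex_bij_witness[of _ Suc "\<lambda>n. n - 1"]) auto
  also have "\<dots> = (\<Sum>n\<in>insert 0 {1..<m}. real (Suc n) * q ^ n)"
    by (subst sum.insert) auto
  also have "\<dots> \<le> (\<Sum>n. real (Suc n) * q ^ n)"
    by (rule sum_le_suminf) (use sums assms in \<open>auto simp: sums_iff\<close>)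
  finally show ?thesis
    using sums by (simp add: sums_iff)
qed

lemma sum_geometric_tail_le:
  fixes q :: real
  assumes "0 \<le> q" "q < 1"
  shows "(\<Sum>n = 2..m. q ^ n) \<le> q\<^sup>2 / (1 - q)"
proof -
  have "(\<Sum>n = 2..m. q ^ n) = (\<Sum>n\<in>{2..<Suc m}. q ^ n)"
    by (simp add: atLeastLessThanSuc_atLeastAtMost)
  also have "\<dots> = (\<Sum>n\<in>{..<m - 1}. q ^ (n + 2))"
    by (rule sum.reindex_bij_witness[of _ "\<lambda>n. n + 2" "\<lambda>n. n - 2"])
       (auto simp del: add_2_eq_Suc')
  also have "\<dots> = (\<Sum>n\<in>{..<m - 1}. q\<^sup>2 * q ^ n)"
    unfolding power_add by (simp only: mult.commute)
  also have "\<dots> \<le> (\<Sum>n. q\<^sup>2 * q ^ n)"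
    by (rule sum_le_suminf) (use assms in \<open>auto intro!: summable_mult summable_geometric\<close>)
  also have "\<dots> = q\<^sup>2 / (1 - q)"
    using assms by (subst suminf_mult) (auto intro!: summable_geometric simp: suminf_geometric)
  finally show ?thesis .
qed

section \<open>Compositions and majorant series\<close>

definition compositions :: "nat \<Rightarrow> nat \<Rightarrow> nat list set" where
  "compositions n m = {is. length is = n \<and> sum_list is = m \<and> (\<forall>i\<in>set is. i \<ge> 1)}"

lemma compositions_parts_le: "is \<in> compositions n m \<Longrightarrow> set is \<subseteq> {1..m}"
  using member_le_sum_list unfolding compositions_def by fastforce

lemma finite_compositions: "finite (compositions n m)"
proof (rule finite_subset)
  show "compositions n m \<subseteq> {is. set is \<subseteq> {1..m} \<and> length is = n}"
    using compositions_parts_le by (auto simp: compositions_def)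
qed (rule finite_lists_length_eq, simp)

lemma compositions_parts_less:
  "is \<in> compositions n m \<Longrightarrow> n \<ge> 2 \<Longrightarrow> i \<in> set is \<Longrightarrow> i < m"
  using part_less[of i "is"] by (auto simp: compositions_def)

lemma prod_list_map_nonneg:
  fixes f :: "'a \<Rightarrow> real"
  shows "(\<And>x. x \<in> set xs \<Longrightarrow> 0 \<le> f x) \<Longrightarrow> 0 \<le> prod_list (map f xs)"
  by (induction xs) auto

text \<open>Summing over all compositions of \<open>2, ..., m\<close> selects, among the index lists over \<open>{1..m}\<close> that come from
  the multilinear expansion of a power, those of total order at most \<open>m\<close>.\<close>

lemma sum_compositions:
  fixes h :: "nat list \<Rightarrow> real"
  shows "(\<Sum>j = 2..m. \<Sum>n = 2..j. \<Sum>is\<in>compositions n j. h is)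
    = (\<Sum>n = 2..m. \<Sum>is | set is \<subseteq> {1..m} \<and> length is = n \<and> sum_list is \<le> m. h is)"
proof -
  have len: "length is \<le> sum_list is" if "\<forall>i\<in>set is. (i::nat) \<ge> 1" for "is"
    using that by (induction "is") auto
  have "(\<Sum>j = 2..m. \<Sum>n = 2..j. \<Sum>is\<in>compositions n j. h is)
      = (\<Sum>j = 2..m. \<Sum>n = 2..m. \<Sum>is\<in>compositions n j. h is)"
  proof (rule sum.cong[OF refl], rule sum.mono_neutral_left, simp_all, intro ballI)
    fix j n assume "n \<in> {2..m} - {2..j}"
    then have "compositions n j = {}"
      using len by (fastforce simp: compositions_def)
    then show "(\<Sum>is\<in>compositions n j. h is) = 0" by simp
  qed
  also have "\<dots> = (\<Sum>n = 2..m. \<Sum>j = 2..m. \<Sum>is\<in>compositions n j. h is)"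
    by (rule sum.swap)
  also have "\<dots> = (\<Sum>n = 2..m. \<Sum>is | set is \<subseteq> {1..m} \<and> length is = n \<and> sum_list is \<le> m. h is)"
  proof (intro sum.cong refl)
    fix n assume n: "n \<in> {2..m}"
    have "(\<Sum>j = 2..m. \<Sum>is\<in>compositions n j. h is) = (\<Sum>is\<in>(\<Union>j\<in>{2..m}. compositions n j). h is)"
      by (rule sum.UNION_disjoint[symmetric]) (auto simp: finite_compositions, auto simp: compositions_def)
    also have "(\<Union>j\<in>{2..m}. compositions n j)
        = {is. set is \<subseteq> {1..m} \<and> length is = n \<and> sum_list is \<le> m}" (is "?L = ?R")
    proof
      show "?L \<subseteq> ?R"
        using compositions_parts_le by (fastforce simp: compositions_def)
      show "?R \<subseteq> ?L"
      proof
        fix "is" assume *: "is \<in> ?R"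
        then have "is \<in> compositions n (sum_list is)"
          by (auto simp: compositions_def)
        moreover have "n \<le> sum_list is"
          using * len[of "is"] by fastforce
        ultimately show "is \<in> ?L" using * n by auto
      qed
    qed
    finally show "(\<Sum>j = 2..m. \<Sum>is\<in>compositions n j. h is)
      = (\<Sum>is | set is \<subseteq> {1..m} \<and> length is = n \<and> sum_list is \<le> m. h is)" .
  qed
  finally show ?thesis .
qed

text \<open>A number \<open>X\<close> with \<open>d 1 + f X \<le> X\<close>, where \<open>f X = (\<Sum>n\<ge>2. c n * X ^ n)\<close>, is a barrier. The compositions of
  numbers up to \<open>m + 1\<close> into at least two parts have all parts at most \<open>m\<close>, so the \<open>(m+1)\<close>st partial sum is at
  most \<open>d 1\<close> plus \<open>f\<close> of the \<open>m\<close>th.\<close>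

lemma majorant_bounds_partial_sums:
  fixes c d :: "nat \<Rightarrow> real"
  assumes c: "\<And>n. 0 \<le> c n" and d: "\<And>j. 0 \<le> d j" and X: "0 \<le> X"
    and rec: "\<And>m. m \<ge> 2 \<Longrightarrow> d m \<le> (\<Sum>n = 2..m. \<Sum>is\<in>compositions n m. c n * prod_list (map d is))"
    and super: "\<And>m. d 1 + (\<Sum>n = 2..m. c n * X ^ n) \<le> X"
  shows "(\<Sum>j = 1..m. d j) \<le> X"
proof (induction m)
  case 0
  then show ?case using X by simp
next
  case (Suc m)
  show ?case
  proof (cases "m = 0")
    case True
    then show ?thesis using super[of 0] by simp
  next
    case False
    have "(\<Sum>j = 1..Suc m. d j) = d 1 + (\<Sum>j = 2..Suc m. d j)"
      by (subst sum.atLeast_Suc_atMost) (auto simp: numeral_2_eq_2)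
    also have "(\<Sum>j = 2..Suc m. d j)
        \<le> (\<Sum>j = 2..Suc m. \<Sum>n = 2..j. \<Sum>is\<in>compositions n j. c (length is) * prod_list (map d is))"
    proof (rule sum_mono)
      fix j assume "j \<in> {2..Suc m}"
      then have "d j \<le> (\<Sum>n = 2..j. \<Sum>is\<in>compositions n j. c n * prod_list (map d is))"
        by (intro rec) simp
      also have "\<dots> = (\<Sum>n = 2..j. \<Sum>is\<in>compositions n j. c (length is) * prod_list (map d is))"
        by (intro sum.cong refl) (simp add: compositions_def)
      finally show "d j \<le> \<dots>" .
    qed
    also have "\<dots> = (\<Sum>n = 2..Suc m. \<Sum>is | set is \<subseteq> {1..Suc m} \<and> length is = n \<and> sum_list is \<le> Suc m.
        c (length is) * prod_list (map d is))"
      by (rule sum_compositions)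
    also have "\<dots> \<le> (\<Sum>n = 2..Suc m. c n * (\<Sum>j = 1..m. d j) ^ n)"
    proof (rule sum_mono)
      fix n assume n: "n \<in> {2..Suc m}"
      have "(\<Sum>is | set is \<subseteq> {1..Suc m} \<and> length is = n \<and> sum_list is \<le> Suc m.
          c (length is) * prod_list (map d is))
        \<le> (\<Sum>is | set is \<subseteq> {1..m} \<and> length is = n. c n * prod_list (map d is))"
      proof (rule order_trans[OF eq_refl sum_mono2])
        show "finite {is. set is \<subseteq> {1..m} \<and> length is = n}"
          by (rule finite_lists_length_eq) simp
        show "{is. set is \<subseteq> {1..Suc m} \<and> length is = n \<and> sum_list is \<le> Suc m}
            \<subseteq> {is. set is \<subseteq> {1..m} \<and> length is = n}"
        proof safe
          fix "is" i assume *: "set is \<subseteq> {1..Suc m}" "sum_list is \<le> Suc m" "i \<in> set is" "n = length is"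
          then have "i < sum_list is"
            using n by (intro part_less) auto
          then show "i \<in> {1..m}" using * by auto
        qed
      qed (auto intro!: mult_nonneg_nonneg prod_list_map_nonneg c d)
      also have "\<dots> = c n * (\<Sum>j = 1..m. d j) ^ n"
        by (simp add: sum_distrib_left[symmetric] sum_prod_list_eq_power)
      finally show "(\<Sum>is | set is \<subseteq> {1..Suc m} \<and> length is = n \<and> sum_list is \<le> Suc m.
          c (length is) * prod_list (map d is)) \<le> c n * (\<Sum>j = 1..m. d j) ^ n" .
    qed
    also have "\<dots> \<le> (\<Sum>n = 2..Suc m. c n * X ^ n)"
      by (intro sum_mono mult_left_mono power_mono Suc.IH c sum_nonneg d)
    finally show ?thesis using super[of "Suc m"] by simp
  qed
qed

text \<open>A weight that is exponential in the order is multiplicative along compositions.\<close>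

lemma prod_list_weighted:
  "prod_list (map (\<lambda>j. 2 ^ j * f j) is) = 2 ^ sum_list is * prod_list (map f is)"
  for f :: "nat \<Rightarrow> real"
  by (induction "is") (auto simp: power_add mult_ac)

section \<open>Bounded multilinear operators\<close>

text \<open>Multilinearity enters only through additivity in each slot, so homogeneity is left out. The
  operators are watched on \<open>closure \<Omega> \<times> \<partial>\<Omega>\<close>, not just on the boundary, because the recursion integrates
  their values over \<open>\<Omega>\<close>.\<close>

definition bounded_multilinear ::
    "'a::euclidean_space set \<Rightarrow> nat \<Rightarrow> real \<Rightarrow> 'a multiop \<Rightarrow> bool" where
  "bounded_multilinear \<Omega> n c T \<longleftrightarrow>
     (\<forall>fs. length fs = n \<longrightarrow> set fs \<subseteq> Linf \<Omega> \<longrightarrow>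
        continuous_on (closure \<Omega> \<times> frontier \<Omega>) (T fs) \<and>
        (\<forall>z\<in>closure \<Omega> \<times> frontier \<Omega>. \<bar>T fs z\<bar> \<le> c * prod_list (map (Linf_norm \<Omega>) fs)) \<and>
        (\<forall>i<n. \<forall>f\<in>Linf \<Omega>. \<forall>h\<in>Linf \<Omega>. \<forall>z\<in>closure \<Omega> \<times> frontier \<Omega>.
           T (fs[i := \<lambda>x. f x + h x]) z = T (fs[i := f]) z + T (fs[i := h]) z))"

lemma bounded_multilinear_continuous:
  "bounded_multilinear \<Omega> n c T \<Longrightarrow> length fs = n \<Longrightarrow> set fs \<subseteq> Linf \<Omega> \<Longrightarrow>
    continuous_on (closure \<Omega> \<times> frontier \<Omega>) (T fs)"
  unfolding bounded_multilinear_def by blast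

lemma bounded_multilinear_bound:
  "bounded_multilinear \<Omega> n c T \<Longrightarrow> length fs = n \<Longrightarrow> set fs \<subseteq> Linf \<Omega> \<Longrightarrow>
    z \<in> closure \<Omega> \<times> frontier \<Omega> \<Longrightarrow> \<bar>T fs z\<bar> \<le> c * prod_list (map (Linf_norm \<Omega>) fs)"
  unfolding bounded_multilinear_def by blast

lemma bounded_multilinear_add:
  "bounded_multilinear \<Omega> n c T \<Longrightarrow> length fs = n \<Longrightarrow> set fs \<subseteq> Linf \<Omega> \<Longrightarrow> i < n \<Longrightarrow>
    f \<in> Linf \<Omega> \<Longrightarrow> h \<in> Linf \<Omega> \<Longrightarrow> z \<in> closure \<Omega> \<times> frontier \<Omega> \<Longrightarrow>
    T (fs[i := \<lambda>x. f x + h x]) z = T (fs[i := f]) z + T (fs[i := h]) z"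
  unfolding bounded_multilinear_def by blast

lemma bounded_multilinear_tensor:
  assumes T: "bounded_multilinear \<Omega> l c T" and S: "bounded_multilinear \<Omega> m d S"
  shows "bounded_multilinear \<Omega> (l + m) (c * d) (tensor l T S)"
  unfolding bounded_multilinear_def
proof (intro allI impI conjI ballI)
  fix fs :: "('a \<Rightarrow> real) list" assume fs: "length fs = l + m" "set fs \<subseteq> Linf \<Omega>"
  have len: "length (take l fs) = l" "length (drop l fs) = m" using fs by auto
  have sub: "set (take l fs) \<subseteq> Linf \<Omega>" "set (drop l fs) \<subseteq> Linf \<Omega>"
    using fs set_take_subset[of l fs] set_drop_subset[of l fs] by blast+
  show "continuous_on (closure \<Omega> \<times> frontier \<Omega>) (tensor l T S fs)"
    unfolding tensor_def
    by (intro continuous_on_mult bounded_multilinear_continuous[OF T] bounded_multilinear_continuous[OF S] len sub)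
  show "\<bar>tensor l T S fs z\<bar> \<le> c * d * prod_list (map (Linf_norm \<Omega>) fs)"
    if z: "z \<in> closure \<Omega> \<times> frontier \<Omega>" for z
  proof -
    note b = bounded_multilinear_bound[OF T len(1) sub(1) z] bounded_multilinear_bound[OF S len(2) sub(2) z]
    have "\<bar>tensor l T S fs z\<bar> \<le> (c * prod_list (map (Linf_norm \<Omega>) (take l fs)))
        * (d * prod_list (map (Linf_norm \<Omega>) (drop l fs)))"
      unfolding tensor_def abs_mult using b abs_ge_zero order_trans by (intro mult_mono) blast+
    also have "\<dots> = c * d * prod_list (map (Linf_norm \<Omega>) (take l fs @ drop l fs))"
      by (simp only: map_append prod_list.append mult_ac)
    finally show ?thesis by simp
  qed
  fix i f h z
  assume *: "i < l + m" "f \<in> Linf \<Omega>" "h \<in> Linf \<Omega>" "z \<in> closure \<Omega> \<times> frontier \<Omega>"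
  show "tensor l T S (fs[i := \<lambda>x. f x + h x]) z = tensor l T S (fs[i := f]) z + tensor l T S (fs[i := h]) z"
  proof (cases "i < l")
    case True
    then show ?thesis
      using bounded_multilinear_add[OF T len(1) sub(1) True *(2-4)]
      by (simp add: tensor_def take_update_swap algebra_simps)
  next
    case False
    then have "i - l < m" using * by auto
    then show ?thesis
      using bounded_multilinear_add[OF S len(2) sub(2) _ *(2-4), of "i - l"] False
      by (simp add: tensor_def drop_update_swap algebra_simps)
  qed
qed

lemma bounded_multilinear_sum:
  fixes \<Omega> :: "'a::euclidean_space set"
  assumes T: "\<And>p. p \<in> I \<Longrightarrow> bounded_multilinear \<Omega> n (c p) (T p)"
  shows "bounded_multilinear \<Omega> n (\<Sum>p\<in>I. c p) (\<lambda>fs z. \<Sum>p\<in>I. T p fs z)"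
  unfolding bounded_multilinear_def
proof (intro allI impI conjI ballI)
  fix fs :: "('a \<Rightarrow> real) list" assume fs: "length fs = n" "set fs \<subseteq> Linf \<Omega>"
  show "continuous_on (closure \<Omega> \<times> frontier \<Omega>) (\<lambda>z. \<Sum>p\<in>I. T p fs z)"
    by (intro continuous_on_sum bounded_multilinear_continuous[OF T] fs)
  show "\<bar>\<Sum>p\<in>I. T p fs z\<bar> \<le> (\<Sum>p\<in>I. c p) * prod_list (map (Linf_norm \<Omega>) fs)"
    if "z \<in> closure \<Omega> \<times> frontier \<Omega>" for z
    unfolding sum_distrib_right
    by (intro order_trans[OF sum_abs] sum_mono bounded_multilinear_bound[OF T] fs that)
  show "(\<Sum>p\<in>I. T p (fs[i := \<lambda>x. f x + h x]) z) = (\<Sum>p\<in>I. T p (fs[i := f]) z) + (\<Sum>p\<in>I. T p (fs[i := h]) z)"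
    if "i < n" "f \<in> Linf \<Omega>" "h \<in> Linf \<Omega>" "z \<in> closure \<Omega> \<times> frontier \<Omega>" for i f h z
    unfolding sum.distrib[symmetric]
    by (intro sum.cong refl bounded_multilinear_add[OF T] fs that)
qed

lemma bounded_multilinear_const:
  assumes "continuous_on (closure \<Omega> \<times> frontier \<Omega>) u"
    and "\<And>z. z \<in> closure \<Omega> \<times> frontier \<Omega> \<Longrightarrow> \<bar>u z\<bar> \<le> c"
  shows "bounded_multilinear \<Omega> 0 c (\<lambda>_. u)"
  using assms by (simp add: bounded_multilinear_def)

context singular_kernel begin

lemma b_op_integrable:
  assumes f: "f \<in> Linf \<Omega>" and v: "continuous_on (closure \<Omega> \<times> frontier \<Omega>) v"
    and v_le: "\<And>z. z \<in> closure \<Omega> \<times> frontier \<Omega> \<Longrightarrow> \<bar>v z\<bar> \<le> c"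
    and z: "x \<in> closure \<Omega>" "s \<in> frontier \<Omega>"
  shows "integrable (lebesgue_on \<Omega>) (\<lambda>y. H x y * f y * v (y, s))"
proof -
  have [measurable]: "f \<in> borel_measurable (lebesgue_on \<Omega>)"
    "(\<lambda>y. v (y, s)) \<in> borel_measurable (lebesgue_on \<Omega>)"
    using f open_domain v z by (auto intro: Linf_measurable closure_section_measurable)
  have "AE y in lebesgue_on \<Omega>. \<bar>f y * v (y, s)\<bar> \<le> Linf_norm \<Omega> f * c"
    using AE_le_Linf_norm[OF f] AE_space
  proof eventually_elim
    case (elim y)
    then have "y \<in> closure \<Omega>" using closure_subset by auto
    then show ?case
      unfolding abs_mult using elim v_le[of "(y, s)"] z by (intro mult_mono) auto
  qed
  then have "integrable (lebesgue_on \<Omega>) (\<lambda>y. H x y * (f y * v (y, s)))"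
    by (intro kernel_mult_integrable z) auto
  then show ?thesis by (simp add: mult.assoc)
qed

lemma continuous_b_op:
  assumes f: "f \<in> Linf \<Omega>" and v: "continuous_on (closure \<Omega> \<times> frontier \<Omega>) v"
  shows "continuous_on (closure \<Omega> \<times> frontier \<Omega>) (b_op \<Omega> k H v f)"
proof -
  have "continuous_on (closure \<Omega> \<times> frontier \<Omega>) (\<lambda>(x, s). LINT y|lebesgue_on \<Omega>. H x y * f y * v (y, s))"
    by (rule continuous_integral_operator)
       (use f v bounded_domain in \<open>auto intro: compact_frontier_bounded Linf_measurable AE_le_Linf_norm\<close>)
  then have "continuous_on (closure \<Omega> \<times> frontier \<Omega>)
      (\<lambda>z. - k\<^sup>2 * (case z of (x, s) \<Rightarrow> LINT y|lebesgue_on \<Omega>. H x y * f y * v (y, s)))"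
    by (intro continuous_intros)
  then show ?thesis by (simp add: b_op_def case_prod_unfold)
qed

lemma abs_b_op_le:
  assumes f: "f \<in> Linf \<Omega>" and v: "continuous_on (closure \<Omega> \<times> frontier \<Omega>) v"
    and v_le: "\<And>z. z \<in> closure \<Omega> \<times> frontier \<Omega> \<Longrightarrow> \<bar>v z\<bar> \<le> c"
    and z: "z \<in> closure \<Omega> \<times> frontier \<Omega>"
  shows "\<bar>b_op \<Omega> k H v f z\<bar>
    \<le> k\<^sup>2 * (SUP x\<in>\<Omega>. LINT y|lebesgue_on \<Omega>. \<bar>H x y\<bar>) * (c * Linf_norm \<Omega> f)"
proof -
  obtain x s where xs: "z = (x, s)" "x \<in> closure \<Omega>" "s \<in> frontier \<Omega>" using z by auto
  note int = b_op_integrable[OF f v v_le xs(2,3)]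
  have c0: "0 \<le> c" using v_le[OF z] by linarith
  have "\<bar>LINT y|lebesgue_on \<Omega>. H x y * f y * v (y, s)\<bar> \<le> (LINT y|lebesgue_on \<Omega>. \<bar>H x y * f y * v (y, s)\<bar>)"
    by (rule integral_abs_bound)
  also have "\<dots> \<le> (LINT y|lebesgue_on \<Omega>. \<bar>H x y\<bar> * (c * Linf_norm \<Omega> f))"
  proof (rule integral_mono_AE)
    show "AE y in lebesgue_on \<Omega>. \<bar>H x y * f y * v (y, s)\<bar> \<le> \<bar>H x y\<bar> * (c * Linf_norm \<Omega> f)"
      using AE_le_Linf_norm[OF f] AE_space
    proof eventually_elim
      case (elim y)
      then have "y \<in> closure \<Omega>" using closure_subset by auto
      then have "\<bar>v (y, s)\<bar> * \<bar>f y\<bar> \<le> c * Linf_norm \<Omega> f"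
        using elim v_le[of "(y, s)"] xs c0 by (intro mult_mono) auto
      then show ?case
        using mult_left_mono[of "\<bar>v (y, s)\<bar> * \<bar>f y\<bar>" "c * Linf_norm \<Omega> f" "\<bar>H x y\<bar>"]
        by (simp add: abs_mult mult_ac)
    qed
  qed (use int kernel_integrable[OF xs(2)] in \<open>auto intro: integrable_mult_left\<close>)
  also have "\<dots> = (LINT y|lebesgue_on \<Omega>. \<bar>H x y\<bar>) * (c * Linf_norm \<Omega> f)"
    by simp
  also have "\<dots> \<le> (SUP x\<in>\<Omega>. LINT y|lebesgue_on \<Omega>. \<bar>H x y\<bar>) * (c * Linf_norm \<Omega> f)"
    by (intro mult_right_mono integral_abs_kernel_le xs mult_nonneg_nonneg c0 Linf_norm_nonneg)
  finally show ?thesis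
    by (simp add: b_op_def xs abs_mult mult_left_mono mult.assoc)
qed

text \<open>The last argument is the density of the integral operator and the others are arguments of \<open>T\<close>;
  additivity in either place is linearity of the integral, valid because all integrands are integrable.\<close>

lemma bounded_multilinear_B_op:
  assumes T: "bounded_multilinear \<Omega> n c T"
  shows "bounded_multilinear \<Omega> (Suc n) (k\<^sup>2 * (SUP x\<in>\<Omega>. LINT y|lebesgue_on \<Omega>. \<bar>H x y\<bar>) * c) (B_op \<Omega> k H T)"
  unfolding bounded_multilinear_def
proof (intro allI impI conjI ballI)
  fix fs :: "('a \<Rightarrow> real) list" assume fs: "length fs = Suc n" "set fs \<subseteq> Linf \<Omega>"
  have ne: "fs \<noteq> []" using fs by auto
  have but: "length (butlast fs) = n" "set (butlast fs) \<subseteq> Linf \<Omega>" and last: "last fs \<in> Linf \<Omega>"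
    using fs ne by (auto dest: in_set_butlastD)
  note cont = bounded_multilinear_continuous[OF T]
  show "continuous_on (closure \<Omega> \<times> frontier \<Omega>) (B_op \<Omega> k H T fs)"
    unfolding B_op_def by (intro continuous_b_op last cont but)
  show "\<bar>B_op \<Omega> k H T fs z\<bar> \<le> k\<^sup>2 * (SUP x\<in>\<Omega>. LINT y|lebesgue_on \<Omega>. \<bar>H x y\<bar>) * c * prod_list (map (Linf_norm \<Omega>) fs)"
    if z: "z \<in> closure \<Omega> \<times> frontier \<Omega>" for z
  proof -
    have "prod_list (map (Linf_norm \<Omega>) fs) = prod_list (map (Linf_norm \<Omega>) (butlast fs)) * Linf_norm \<Omega> (last fs)"
      using arg_cong[OF append_butlast_last_id[OF ne, symmetric], of "\<lambda>fs. prod_list (map (Linf_norm \<Omega>) fs)"]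
      by simp
    then show ?thesis
      using abs_b_op_le[OF last cont[OF but] bounded_multilinear_bound[OF T but] z, of k]
      by (simp add: B_op_def mult.assoc)
  qed
  fix i f h z
  assume *: "i < Suc n" "f \<in> Linf \<Omega>" "h \<in> Linf \<Omega>" "z \<in> closure \<Omega> \<times> frontier \<Omega>"
  obtain x s where xs: "z = (x, s)" "x \<in> closure \<Omega>" "s \<in> frontier \<Omega>" using * by auto
  have int: "integrable (lebesgue_on \<Omega>) (\<lambda>y. H x y * q y * T gs (y, s))"
    if "q \<in> Linf \<Omega>" "length gs = n" "set gs \<subseteq> Linf \<Omega>" for q gs
    by (rule b_op_integrable[OF that(1) cont bounded_multilinear_bound[OF T] xs(2,3)]) (use that in auto)
  show "B_op \<Omega> k H T (fs[i := \<lambda>x. f x + h x]) z = B_op \<Omega> k H T (fs[i := f]) z + B_op \<Omega> k H T (fs[i := h]) z"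
  proof (cases "i = n")
    case True
    have "(LINT y|lebesgue_on \<Omega>. H x y * (f y + h y) * T (butlast fs) (y, s))
        = (LINT y|lebesgue_on \<Omega>. H x y * f y * T (butlast fs) (y, s) + H x y * h y * T (butlast fs) (y, s))"
      by (simp add: algebra_simps)
    also have "\<dots> = (LINT y|lebesgue_on \<Omega>. H x y * f y * T (butlast fs) (y, s))
        + (LINT y|lebesgue_on \<Omega>. H x y * h y * T (butlast fs) (y, s))"
      by (intro Bochner_Integration.integral_add int *(2,3) but)
    finally show ?thesis
      using True fs ne by (simp add: B_op_def b_op_def xs butlast_list_update last_list_update distrib_left)
  next
    case False
    then have i: "i < n" using * by auto
    let ?g = "\<lambda>q. (butlast fs)[i := q]"
    have upd: "length (?g q) = n" "q \<in> Linf \<Omega> \<Longrightarrow> set (?g q) \<subseteq> Linf \<Omega>" for q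
      using but set_update_subset_insert[of "butlast fs" i q] by auto
    have "(LINT y|lebesgue_on \<Omega>. H x y * last fs y * T (?g (\<lambda>x. f x + h x)) (y, s))
        = (LINT y|lebesgue_on \<Omega>. H x y * last fs y * T (?g f) (y, s) + H x y * last fs y * T (?g h) (y, s))"
    proof (rule Bochner_Integration.integral_cong[OF refl])
      fix y assume "y \<in> space (lebesgue_on \<Omega>)"
      then have "(y, s) \<in> closure \<Omega> \<times> frontier \<Omega>" using xs closure_subset by auto
      from bounded_multilinear_add[OF T but i *(2,3) this]
      show "H x y * last fs y * T (?g (\<lambda>x. f x + h x)) (y, s)
          = H x y * last fs y * T (?g f) (y, s) + H x y * last fs y * T (?g h) (y, s)"
        by (simp only: distrib_left)
    qed
    also have "\<dots> = (LINT y|lebesgue_on \<Omega>. H x y * last fs y * T (?g f) (y, s))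
        + (LINT y|lebesgue_on \<Omega>. H x y * last fs y * T (?g h) (y, s))"
      by (intro Bochner_Integration.integral_add int last upd *(2,3))
    finally show ?thesis
      using False fs ne by (simp add: B_op_def b_op_def xs butlast_list_update last_list_update distrib_left)
  qed
qed

text \<open>If \<open>a n\<close> bounds the operator of order \<open>n\<close>, the recursion gives \<open>a (n+1) = \<mu> * (\<Sum> a i * a j * a l)\<close> with
  \<open>a 0 = N\<close>. Scaling out \<open>N\<close> and \<open>\<mu>\<close> leaves the numbers of ternary trees.\<close>

lemma bounded_multilinear_born:
  assumes u0: "continuous_on (closure \<Omega> \<times> frontier \<Omega>) u0"
    and N: "\<And>z. z \<in> closure \<Omega> \<times> frontier \<Omega> \<Longrightarrow> \<bar>u0 z\<bar> \<le> N"
    and \<mu>: "\<mu> = k\<^sup>2 * (SUP x\<in>\<Omega>. LINT y|lebesgue_on \<Omega>. \<bar>H x y\<bar>)"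
  shows "bounded_multilinear \<Omega> n (N ^ (2 * n + 1) * \<mu> ^ n * ternary_trees n) (born \<Omega> k H u0 n)"
proof (induction n rule: less_induct)
  case (less n)
  define a where "a n = N ^ (2 * n + 1) * \<mu> ^ n * ternary_trees n" for n
  show ?case
  proof (cases n)
    case 0
    then show ?thesis
      by (simp add: bounded_multilinear_const[OF u0 N])
  next
    case (Suc m)
    let ?I = "{(i, j, l). i + j + l = m}"
    let ?K = "born \<Omega> k H u0"
    define P where "P = (\<lambda>(i, j, l). tensor (i + j) (tensor i (?K i) (?K j)) (?K l))"
    have IH: "bounded_multilinear \<Omega> i (a i) (?K i)" if "i \<le> m" for i
      using less.IH[of i] that Suc by (simp add: a_def)
    have "bounded_multilinear \<Omega> m (case p of (i, j, l) \<Rightarrow> a i * a j * a l) (P p)" if "p \<in> ?I" for p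
    proof -
      obtain i j l where p: "p = (i, j, l)" "i + j + l = m" using \<open>p \<in> ?I\<close> by auto
      then have "bounded_multilinear \<Omega> (i + j + l) (a i * a j * a l) (P p)"
        unfolding P_def p(1) prod.case by (intro bounded_multilinear_tensor IH) auto
      then show ?thesis using p by simp
    qed
    then have "bounded_multilinear \<Omega> (Suc m) (\<mu> * (\<Sum>(i, j, l)\<in>?I. a i * a j * a l))
        (B_op \<Omega> k H (\<lambda>fs z. \<Sum>p\<in>?I. P p fs z))"
      unfolding \<mu> by (intro bounded_multilinear_B_op bounded_multilinear_sum)
    also have "(\<lambda>fs z. \<Sum>p\<in>?I. P p fs z)
        = (\<lambda>fs z. \<Sum>(i, j, l)\<in>?I. tensor (i + j) (tensor i (?K i) (?K j)) (?K l) fs z)"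
      by (intro ext sum.cong refl) (auto simp: P_def)
    also have "B_op \<Omega> k H \<dots> = ?K n"
      by (simp only: Suc born.simps)
    also have "\<mu> * (\<Sum>(i, j, l)\<in>?I. a i * a j * a l) = N ^ (2 * n + 1) * \<mu> ^ n * ternary_trees n"
    proof -
      have prod: "a i * a j * a l
          = N ^ (2 * m + 3) * \<mu> ^ m * (ternary_trees i * ternary_trees j * ternary_trees l)"
        if m: "i + j + l = m" for i j l
      proof -
        have "N ^ (2 * m + 3) = N ^ (2 * i + 1) * N ^ (2 * j + 1) * N ^ (2 * l + 1)"
          unfolding m[symmetric] by (simp only: power_add[symmetric]) (simp add: algebra_simps numeral_3_eq_3)
        then show ?thesis
          unfolding a_def m[symmetric] by (simp only: power_add[of \<mu>] mult_ac)
      qed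
      have "(\<Sum>(i, j, l)\<in>?I. a i * a j * a l)
          = (\<Sum>(i, j, l)\<in>?I. N ^ (2 * m + 3) * \<mu> ^ m * (ternary_trees i * ternary_trees j * ternary_trees l))"
      proof (rule sum.cong[OF refl])
        fix p assume "p \<in> ?I"
        then obtain i j l where "p = (i, j, l)" "i + j + l = m" by auto
        then show "(case p of (i, j, l) \<Rightarrow> a i * a j * a l)
            = (case p of (i, j, l) \<Rightarrow> N ^ (2 * m + 3) * \<mu> ^ m
                * (ternary_trees i * ternary_trees j * ternary_trees l))"
          by (simp only: prod.case prod)
      qed
      also have "\<dots> = N ^ (2 * m + 3) * \<mu> ^ m * ternary_trees n"
        unfolding Suc ternary_trees.simps sum_distrib_left
        by (intro sum.cong) auto
      finally show ?thesis
        by (simp add: Suc numeral_3_eq_3)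
    qed
    finally show ?thesis by (simp only: Suc)
  qed
qed

end

lemma bounded_multilinear_slot:
  assumes T: "bounded_multilinear \<Omega> n c T" and n: "length fs + Suc (length gs) = n"
    and sub: "set fs \<subseteq> Linf \<Omega>" "set gs \<subseteq> Linf \<Omega>" and fh: "f \<in> Linf \<Omega>" "h \<in> Linf \<Omega>"
    and z: "z \<in> closure \<Omega> \<times> frontier \<Omega>"
  shows "T (fs @ (\<lambda>x. f x + h x) # gs) z = T (fs @ f # gs) z + T (fs @ h # gs) z"
  using bounded_multilinear_add[OF T, of "fs @ f # gs" "length fs" f h z] assms by simp

lemma bounded_multilinear_slot_sum:
  assumes T: "bounded_multilinear \<Omega> n c T" and n: "length fs + Suc (length gs) = n"
    and sub: "set fs \<subseteq> Linf \<Omega>" "set gs \<subseteq> Linf \<Omega>" and f: "\<And>i. i \<in> I \<Longrightarrow> f i \<in> Linf \<Omega>"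
    and z: "z \<in> closure \<Omega> \<times> frontier \<Omega>" and fin: "finite I"
  shows "T (fs @ (\<lambda>x. \<Sum>i\<in>I. f i x) # gs) z = (\<Sum>i\<in>I. T (fs @ f i # gs) z)"
  using fin f
proof (induction I rule: finite_induct)
  case empty
  show ?case
    \<comment> \<open>Additivity at \<open>0 + 0\<close> forces the value \<open>0\<close>.\<close>
    using bounded_multilinear_slot[OF T n sub Linf_zero Linf_zero z] by simp
next
  case (insert i I)
  have "T (fs @ (\<lambda>x. f i x + (\<Sum>i\<in>I. f i x)) # gs) z
      = T (fs @ f i # gs) z + T (fs @ (\<lambda>x. \<Sum>i\<in>I. f i x) # gs) z"
    by (intro bounded_multilinear_slot[OF T n sub _ _ z] Linf_sum insert.prems) auto
  then show ?case using insert by simp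
qed

lemma bounded_multilinear_expand:
  assumes T: "bounded_multilinear \<Omega> n c T" and f: "\<And>i. i \<in> I \<Longrightarrow> f i \<in> Linf \<Omega>"
    and z: "z \<in> closure \<Omega> \<times> frontier \<Omega>" and fin: "finite I"
  shows "T (replicate n (\<lambda>x. \<Sum>i\<in>I. f i x)) z = (\<Sum>is | set is \<subseteq> I \<and> length is = n. T (map f is) z)"
proof -
  let ?s = "\<lambda>x. \<Sum>i\<in>I. f i x"
  have s: "?s \<in> Linf \<Omega>" by (intro Linf_sum f)
  have "T (fs @ replicate r ?s) z = (\<Sum>is | set is \<subseteq> I \<and> length is = r. T (fs @ map f is) z)"
    if "set fs \<subseteq> Linf \<Omega>" "length fs + r = n" for r fs
    using that
  proof (induction r arbitrary: fs)
    case 0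
    have "{is. set is \<subseteq> I \<and> length is = 0} = {[]}" by auto
    then show ?case by simp
  next
    case (Suc r)
    have "T (fs @ replicate (Suc r) ?s) z = (\<Sum>i\<in>I. T (fs @ f i # replicate r ?s) z)"
      unfolding replicate_Suc
      by (rule bounded_multilinear_slot_sum[OF T]) (use Suc.prems s f z fin in auto)
    also have "\<dots> = (\<Sum>i\<in>I. T ((fs @ [f i]) @ replicate r ?s) z)"
      by simp
    also have "\<dots> = (\<Sum>i\<in>I. \<Sum>is | set is \<subseteq> I \<and> length is = r. T ((fs @ [f i]) @ map f is) z)"
      by (intro sum.cong refl Suc.IH) (use Suc.prems f in auto)
    also have "\<dots> = (\<Sum>is | set is \<subseteq> I \<and> length is = r. \<Sum>i\<in>I. T (fs @ map f (i # is)) z)"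
      by (subst sum.swap) simp
    also have "\<dots> = (\<Sum>(is, i)\<in>{is. set is \<subseteq> I \<and> length is = r} \<times> I. T (fs @ map f (i # is)) z)"
      by (simp only: sum.cartesian_product)
    also have "\<dots> = (\<Sum>is | set is \<subseteq> I \<and> length is = Suc r. T (fs @ map f is) z)"
      unfolding lists_length_Suc_eq by (subst sum.reindex) (auto simp: inj_on_def case_prod_unfold)
    finally show ?case .
  qed
  from this[of "[]" n] show ?thesis by simp
qed

text \<open>Telescoping: replace the copies of \<open>h\<close> by \<open>f\<close> one slot at a time. Each of the \<open>n\<close> exchanges costs the
  operator with \<open>f - h\<close> in one slot and functions of norm at most \<open>M\<close> in the others.\<close>

lemma bounded_multilinear_diff_le:
  assumes T: "bounded_multilinear \<Omega> n c T" and c: "0 \<le> c" and fh: "f \<in> Linf \<Omega>" "h \<in> Linf \<Omega>"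
    and M: "Linf_norm \<Omega> f \<le> M" "Linf_norm \<Omega> h \<le> M" and z: "z \<in> closure \<Omega> \<times> frontier \<Omega>"
  shows "\<bar>T (replicate n f) z - T (replicate n h) z\<bar> \<le> real n * c * M ^ (n - 1) * Linf_norm \<Omega> (\<lambda>x. f x - h x)"
proof -
  have d: "(\<lambda>x. f x - h x) \<in> Linf \<Omega>" by (intro Linf_diff fh)
  define t where "t i = T (replicate i f @ replicate (n - i) h) z" for i
  have M0: "0 \<le> M" using M Linf_norm_nonneg[of \<Omega> f] by linarith
  have step: "\<bar>t (Suc i) - t i\<bar> \<le> c * M ^ (n - 1) * Linf_norm \<Omega> (\<lambda>x. f x - h x)" if i: "i < n" for i
  proof -
    let ?fs = "replicate i f" and ?gs = "replicate (n - Suc i) h"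
    have len: "length ?fs + Suc (length ?gs) = n" using i by simp
    have sub: "set ?fs \<subseteq> Linf \<Omega>" "set ?gs \<subseteq> Linf \<Omega>" using fh by auto
    have "T (?fs @ (\<lambda>x. h x + (f x - h x)) # ?gs) z = T (?fs @ h # ?gs) z + T (?fs @ (\<lambda>x. f x - h x) # ?gs) z"
      by (rule bounded_multilinear_slot[OF T len sub fh(2) d z])
    moreover have "replicate (Suc i) f @ replicate (n - Suc i) h = ?fs @ f # ?gs"
      by (simp add: replicate_append_same)
    moreover have "replicate (n - i) h = h # ?gs"
      using i by (metis Suc_diff_Suc replicate_Suc)
    ultimately have "t (Suc i) - t i = T (?fs @ (\<lambda>x. f x - h x) # ?gs) z"
      by (simp add: t_def)
    also have "\<bar>\<dots>\<bar> \<le> c * prod_list (map (Linf_norm \<Omega>) (?fs @ (\<lambda>x. f x - h x) # ?gs))"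
      by (rule bounded_multilinear_bound[OF T _ _ z]) (use i sub d in auto)
    also have "prod_list (map (Linf_norm \<Omega>) (?fs @ (\<lambda>x. f x - h x) # ?gs))
        = Linf_norm \<Omega> f ^ i * Linf_norm \<Omega> h ^ (n - Suc i) * Linf_norm \<Omega> (\<lambda>x. f x - h x)"
      by (simp add: prod_list_replicate)
    also have "\<dots> \<le> M ^ i * M ^ (n - Suc i) * Linf_norm \<Omega> (\<lambda>x. f x - h x)"
      by (intro mult_right_mono mult_mono power_mono M Linf_norm_nonneg zero_le_power M0)
    also have "M ^ i * M ^ (n - Suc i) = M ^ (n - 1)"
      using i by (simp add: power_add[symmetric])
    finally show ?thesis using c by (simp add: mult_left_mono mult.assoc)
  qed
  have "\<bar>t n - t 0\<bar> = \<bar>\<Sum>i<n. t (Suc i) - t i\<bar>"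
    by (simp add: sum_lessThan_telescope)
  also have "\<dots> \<le> (\<Sum>i<n. c * M ^ (n - 1) * Linf_norm \<Omega> (\<lambda>x. f x - h x))"
    by (intro order_trans[OF sum_abs] sum_mono step) simp
  finally show ?thesis by (simp add: t_def mult.assoc)
qed

section \<open>The inverse Born series and its truncation error\<close>

text \<open>Only the bounds \<open>\<kappa> * a n \<le> \<sigma> * p ^ (n - 1)\<close> on the forward operators matter for the inverse series, so the
  Born recursion is left behind here. The two smallness conditions make \<open>4 * \<delta>\<close> a barrier for the majorant
  series of \<open>2 ^ j * norm (\<eta> j)\<close>: the factor \<open>4\<close>, instead of the \<open>2\<close> that bare convergence would need, pays
  for the weights \<open>2 ^ j\<close>.\<close>

locale inverse_born_series = boundary_operator \<Omega> T
  for \<Omega> :: "'a::euclidean_space set" and T :: "('a \<times> 'a \<Rightarrow> real) \<Rightarrow> 'a \<Rightarrow> real" +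
  fixes K :: "nat \<Rightarrow> 'a multiop" and a :: "nat \<Rightarrow> real" and p \<sigma> \<delta> :: real and \<phi> :: "'a \<times> 'a \<Rightarrow> real"
  assumes K: "\<And>n. bounded_multilinear \<Omega> n (a n) (K n)"
    and a_nonneg: "\<And>n. 0 \<le> a n"
    and p: "0 < p" and \<sigma>: "0 \<le> \<sigma>"
    and a_le: "\<And>n. n \<ge> 2 \<Longrightarrow> onorm_C_Linf \<Omega> T * a n \<le> \<sigma> * p ^ (n - 1)"
    and \<phi>_cont: "continuous_on (bdry2 \<Omega>) \<phi>"
    and \<delta>: "Linf_norm \<Omega> (T \<phi>) \<le> \<delta>"
    and small1: "4 * (p * \<delta>) \<le> 1/2" and small2: "16 * \<sigma> * (p * \<delta>) \<le> 1"
begin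

abbreviation \<kappa> :: real where "\<kappa> \<equiv> onorm_C_Linf \<Omega> T"
abbreviation \<eta> :: "nat \<Rightarrow> 'a \<Rightarrow> real" where "\<eta> \<equiv> inverse_born K T \<phi>"
abbreviation \<eta>_sum :: "nat \<Rightarrow> 'a \<Rightarrow> real" where "\<eta>_sum m \<equiv> \<lambda>x. \<Sum>j = 1..m. \<eta> j x"

lemma bdry_subset: "bdry2 \<Omega> \<subseteq> closure \<Omega> \<times> frontier \<Omega>"
  by (auto simp: frontier_def)

lemma K_continuous: "length fs = n \<Longrightarrow> set fs \<subseteq> Linf \<Omega> \<Longrightarrow> continuous_on (bdry2 \<Omega>) (K n fs)"
  using bounded_multilinear_continuous[OF K] bdry_subset by (rule continuous_on_subset)

lemma norm_TK_le:
  assumes "length fs = n" "set fs \<subseteq> Linf \<Omega>"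
  shows "Linf_norm \<Omega> (T (K n fs)) \<le> \<kappa> * a n * prod_list (map (Linf_norm \<Omega>) fs)"
  using norm_le[OF K_continuous[OF assms] bounded_multilinear_bound[OF K assms]] bdry_subset
  by (auto simp: mult.assoc)

lemma \<eta>_one: "\<eta> 1 = T \<phi>"
  by (simp add: inverse_born.simps)

lemma \<eta>_rec: "m \<ge> 2 \<Longrightarrow> \<eta> m = (\<lambda>x. - (\<Sum>n = 2..m. \<Sum>is\<in>compositions n m. T (K n (map \<eta> is)) x))"
  by (subst inverse_born.simps) (simp add: compositions_def)

lemma \<eta>_Linf: "m \<ge> 1 \<Longrightarrow> \<eta> m \<in> Linf \<Omega>"
proof (induction m rule: less_induct)
  case (less m)
  show ?case
  proof (cases "m = 1")
    case True
    then show ?thesis using \<eta>_one in_Linf[OF \<phi>_cont] by simp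
  next
    case False
    then have m: "m \<ge> 2" using less.prems by simp
    have "T (K n (map \<eta> is)) \<in> Linf \<Omega>" if "n \<in> {2..m}" "is \<in> compositions n m" for n "is"
    proof (intro in_Linf K_continuous)
      show "length (map \<eta> is) = n" using that by (simp add: compositions_def)
      show "set (map \<eta> is) \<subseteq> Linf \<Omega>"
        using that compositions_parts_less[of "is" n m] less.IH by (auto simp: compositions_def)
    qed
    then show ?thesis
      unfolding \<eta>_rec[OF m] by (intro Linf_uminus Linf_sum)
  qed
qed

lemma \<eta>_sum_Linf: "\<eta>_sum m \<in> Linf \<Omega>"
  by (intro Linf_sum \<eta>_Linf) auto

lemma map_\<eta>_Linf: "set is \<subseteq> {1..m} \<Longrightarrow> set (map \<eta> is) \<subseteq> Linf \<Omega>"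
  using \<eta>_Linf by fastforce

lemma norm_TK_\<eta>_le:
  assumes "set is \<subseteq> {1..m}" "length is = n"
  shows "Linf_norm \<Omega> (T (K n (map \<eta> is))) \<le> \<kappa> * a n * prod_list (map (\<lambda>j. Linf_norm \<Omega> (\<eta> j)) is)"
  using norm_TK_le[of "map \<eta> is" n] map_\<eta>_Linf[OF assms(1)] assms(2) by (simp add: o_def)

lemma \<delta>_nonneg: "0 \<le> \<delta>"
  using \<delta> Linf_norm_nonneg[of \<Omega> "T \<phi>"] by linarith

lemma \<kappa>a_nonneg: "0 \<le> \<kappa> * a n"
  using onorm_nonneg a_nonneg by simp

text \<open>With \<open>q = 4 * p * \<delta> \<le> 1/2\<close> the geometric series sums to at most \<open>(\<sigma> / p) * 2 * q^2\<close>, and one factor \<open>q\<close> is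
  absorbed by the second smallness condition.\<close>

lemma majorant_series_le: "(\<Sum>n = 2..m. \<kappa> * a n * (4 * \<delta>) ^ n) \<le> 2 * \<delta>"
proof -
  let ?q = "p * (4 * \<delta>)"
  have q: "0 \<le> ?q" "?q \<le> 1/2"
    using p \<delta>_nonneg small1 by (auto simp: mult_ac)
  have "(\<Sum>n = 2..m. \<kappa> * a n * (4 * \<delta>) ^ n) \<le> (\<Sum>n = 2..m. \<sigma> / p * ?q ^ n)"
  proof (rule sum_mono)
    fix n assume n: "n \<in> {2..m}"
    then have "\<kappa> * a n * (4 * \<delta>) ^ n \<le> \<sigma> * p ^ (n - 1) * (4 * \<delta>) ^ n"
      using a_le \<delta>_nonneg by (intro mult_right_mono) auto
    also have "p ^ (n - 1) = p ^ n / p"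
      using n p by (cases n) auto
    finally show "\<kappa> * a n * (4 * \<delta>) ^ n \<le> \<sigma> / p * ?q ^ n"
      by (simp add: power_mult_distrib)
  qed
  also have "\<dots> \<le> \<sigma> / p * (?q\<^sup>2 / (1 - ?q))"
    unfolding sum_distrib_left[symmetric]
    by (intro mult_left_mono sum_geometric_tail_le) (use q p \<sigma> in auto)
  also have "\<dots> \<le> \<sigma> / p * (?q\<^sup>2 / (1/2))"
    by (intro mult_left_mono divide_left_mono) (use q p \<sigma> in auto)
  also have "\<dots> = 16 * \<sigma> * (p * \<delta>) * (2 * \<delta>)"
    using p by (simp add: power2_eq_square)
  also have "\<dots> \<le> 1 * (2 * \<delta>)"
    by (intro mult_right_mono small2) (use \<delta>_nonneg in auto)
  finally show ?thesis by simp
qed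

text \<open>The weighted norms satisfy the same recursive inequality as the unweighted ones, since \<open>2 ^ m\<close> distributes
  over the parts of a composition of \<open>m\<close>. The weight shows only in the first-order term, which doubles.\<close>

lemma weighted_norm_sum_le: "(\<Sum>j = 1..m. 2 ^ j * Linf_norm \<Omega> (\<eta> j)) \<le> 4 * \<delta>"
proof (rule majorant_bounds_partial_sums[where c = "\<lambda>n. \<kappa> * a n"])
  fix m :: nat assume m: "m \<ge> 2"
  have "Linf_norm \<Omega> (\<eta> m) \<le> (\<Sum>n = 2..m. \<Sum>is\<in>compositions n m.
      \<kappa> * a n * prod_list (map (\<lambda>j. Linf_norm \<Omega> (\<eta> j)) is))"
  proof -
    have TK: "T (K n (map \<eta> is)) \<in> Linf \<Omega>" if "is \<in> compositions n m" for n "is"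
      using that compositions_parts_le[OF that]
      by (intro in_Linf K_continuous map_\<eta>_Linf) (auto simp: compositions_def)
    have "Linf_norm \<Omega> (\<eta> m)
        = Linf_norm \<Omega> (\<lambda>x. \<Sum>n = 2..m. \<Sum>is\<in>compositions n m. T (K n (map \<eta> is)) x)"
      by (simp only: \<eta>_rec[OF m] Linf_norm_uminus)
    also have "\<dots> \<le> (\<Sum>n = 2..m. \<Sum>is\<in>compositions n m. Linf_norm \<Omega> (T (K n (map \<eta> is))))"
      by (intro order_trans[OF Linf_norm_sum] sum_mono Linf_norm_sum Linf_sum TK)
    also have "\<dots> \<le> (\<Sum>n = 2..m. \<Sum>is\<in>compositions n m.
        \<kappa> * a n * prod_list (map (\<lambda>j. Linf_norm \<Omega> (\<eta> j)) is))"
      by (intro sum_mono norm_TK_\<eta>_le[OF compositions_parts_le]) (auto simp: compositions_def)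
    finally show ?thesis .
  qed
  then have "2 ^ m * Linf_norm \<Omega> (\<eta> m) \<le> 2 ^ m * (\<Sum>n = 2..m. \<Sum>is\<in>compositions n m.
      \<kappa> * a n * prod_list (map (\<lambda>j. Linf_norm \<Omega> (\<eta> j)) is))"
    by (rule mult_left_mono) simp
  also have "\<dots> = (\<Sum>n = 2..m. \<Sum>is\<in>compositions n m.
      \<kappa> * a n * prod_list (map (\<lambda>j. 2 ^ j * Linf_norm \<Omega> (\<eta> j)) is))"
    unfolding sum_distrib_left
    by (intro sum.cong refl) (auto simp: prod_list_weighted compositions_def)
  finally show "2 ^ m * Linf_norm \<Omega> (\<eta> m) \<le> \<dots>" .
next
  fix m
  show "2 ^ 1 * Linf_norm \<Omega> (\<eta> 1) + (\<Sum>n = 2..m. \<kappa> * a n * (4 * \<delta>) ^ n) \<le> 4 * \<delta>"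
    using majorant_series_le[of m] \<delta> by (simp only: \<eta>_one) simp
qed (auto intro!: mult_nonneg_nonneg Linf_norm_nonneg \<kappa>a_nonneg \<delta>_nonneg)

text \<open>The terms of total order above \<open>m\<close> in the expansion of \<open>(\<Sum>n = 2..m. T (K n (b, ..., b)))\<close> at the \<open>m\<close>th partial
  sum \<open>b\<close>. The terms of order at most \<open>m\<close> cancel against the inverse series.\<close>

definition remainder :: "nat \<Rightarrow> 'a \<Rightarrow> real" where
  "remainder m x = (\<Sum>n = 2..m. \<Sum>is | set is \<subseteq> {1..m} \<and> length is = n \<and> m < sum_list is. T (K n (map \<eta> is)) x)"

lemma finite_index_lists: "finite {is. set is \<subseteq> {1..m::nat} \<and> length is = n}"
  by (rule finite_lists_length_eq) simp

lemma remainder_Linf: "remainder m \<in> Linf \<Omega>"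
  unfolding remainder_def[abs_def]
  by (intro Linf_sum in_Linf K_continuous map_\<eta>_Linf[of _ m]) auto

text \<open>Every term has total order above \<open>m\<close>, so passing to the weighted norms gains a factor \<open>2 ^ -m\<close>, while the
  weighted majorant series stays bounded.\<close>

lemma norm_remainder_le: "Linf_norm \<Omega> (remainder m) \<le> 2 * \<delta> / 2 ^ m"
proof -
  let ?I = "\<lambda>n. {is. set is \<subseteq> {1..m} \<and> length is = n \<and> m < sum_list is}"
  let ?d = "\<lambda>j. Linf_norm \<Omega> (\<eta> j)"
  have TK: "T (K n (map \<eta> is)) \<in> Linf \<Omega>" if "is \<in> ?I n" for n "is"
    using that by (intro in_Linf K_continuous map_\<eta>_Linf) auto
  have "Linf_norm \<Omega> (remainder m) \<le> (\<Sum>n = 2..m. \<Sum>is\<in>?I n. Linf_norm \<Omega> (T (K n (map \<eta> is))))"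
    unfolding remainder_def[abs_def]
    by (intro order_trans[OF Linf_norm_sum] sum_mono Linf_norm_sum Linf_sum TK)
  also have "\<dots> \<le> (\<Sum>n = 2..m. \<Sum>is\<in>?I n. \<kappa> * a n * prod_list (map (\<lambda>j. 2 ^ j * ?d j) is) / 2 ^ m)"
  proof (intro sum_mono)
    fix n "is" assume "is \<in> ?I n"
    then have idx: "set is \<subseteq> {1..m}" "length is = n" "m \<le> sum_list is" by auto
    have d0: "0 \<le> prod_list (map ?d is)"
      by (rule prod_list_map_nonneg) (rule Linf_norm_nonneg)
    have "2 ^ m * prod_list (map ?d is) \<le> prod_list (map (\<lambda>j. 2 ^ j * ?d j) is)"
      unfolding prod_list_weighted by (intro mult_right_mono d0 power_increasing idx) simp
    then have "\<kappa> * a n * prod_list (map ?d is) \<le> \<kappa> * a n * (prod_list (map (\<lambda>j. 2 ^ j * ?d j) is) / 2 ^ m)"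
      by (intro mult_left_mono \<kappa>a_nonneg) (simp add: field_simps)
    then show "Linf_norm \<Omega> (T (K n (map \<eta> is))) \<le> \<kappa> * a n * prod_list (map (\<lambda>j. 2 ^ j * ?d j) is) / 2 ^ m"
      using norm_TK_\<eta>_le[OF idx(1,2)] by simp
  qed
  also have "\<dots> \<le> (\<Sum>n = 2..m. \<Sum>is | set is \<subseteq> {1..m} \<and> length is = n.
      \<kappa> * a n * prod_list (map (\<lambda>j. 2 ^ j * ?d j) is) / 2 ^ m)"
    by (intro sum_mono sum_mono2 finite_index_lists)
       (auto intro!: divide_nonneg_nonneg mult_nonneg_nonneg[OF \<kappa>a_nonneg] prod_list_map_nonneg
          mult_nonneg_nonneg[OF _ Linf_norm_nonneg])
  also have "\<dots> = (\<Sum>n = 2..m. \<kappa> * a n * (\<Sum>j = 1..m. 2 ^ j * ?d j) ^ n) / 2 ^ m"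
    by (simp add: sum_distrib_left[symmetric] sum_divide_distrib[symmetric] sum_prod_list_eq_power)
  also have "\<dots> \<le> (\<Sum>n = 2..m. \<kappa> * a n * (4 * \<delta>) ^ n) / 2 ^ m"
    by (intro divide_right_mono sum_mono mult_left_mono \<kappa>a_nonneg power_mono weighted_norm_sum_le sum_nonneg)
       (auto intro: mult_nonneg_nonneg[OF _ Linf_norm_nonneg])
  also have "\<dots> \<le> 2 * \<delta> / 2 ^ m"
    by (intro divide_right_mono majorant_series_le) simp
  finally show ?thesis .
qed

text \<open>The inverse series is built to solve \<open>b = T \<phi> - (\<Sum>n\<ge>2. T (K n (b, ..., b)))\<close> formally; its partial sums
  solve it up to the remainder. Working with partial sums keeps every sum finite.\<close>

lemma \<eta>_sum_identity:
  assumes m: "m \<ge> 1"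
  shows "AE x in lebesgue_on \<Omega>.
    \<eta>_sum m x = T \<phi> x - (\<Sum>n = 2..m. T (K n (replicate n (\<eta>_sum m))) x) + remainder m x"
proof -
  have expand: "AE x in lebesgue_on \<Omega>. T (K n (replicate n (\<eta>_sum m))) x
      = (\<Sum>is | set is \<subseteq> {1..m} \<and> length is = n. T (K n (map \<eta> is)) x)" for n
  proof -
    let ?I = "{is. set is \<subseteq> {1..m} \<and> length is = n}"
    have cont: "continuous_on (bdry2 \<Omega>) (K n (map \<eta> is))" if "is \<in> ?I" for "is"
      using that by (intro K_continuous map_\<eta>_Linf) auto
    have "AE x in lebesgue_on \<Omega>. T (K n (replicate n (\<eta>_sum m))) x
        = T (\<lambda>z. \<Sum>is\<in>?I. K n (map \<eta> is) z) x"
    proof (rule cong_AE)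
      show "continuous_on (bdry2 \<Omega>) (K n (replicate n (\<eta>_sum m)))"
        by (intro K_continuous) (use \<eta>_sum_Linf in auto)
      show "continuous_on (bdry2 \<Omega>) (\<lambda>z. \<Sum>is\<in>?I. K n (map \<eta> is) z)"
        by (intro continuous_on_sum cont)
      fix z assume "z \<in> bdry2 \<Omega>"
      then show "K n (replicate n (\<eta>_sum m)) z = (\<Sum>is\<in>?I. K n (map \<eta> is) z)"
        using bdry_subset by (intro bounded_multilinear_expand[OF K]) (auto intro: \<eta>_Linf)
    qed
    moreover have "AE x in lebesgue_on \<Omega>. T (\<lambda>z. \<Sum>is\<in>?I. K n (map \<eta> is) z) x
        = (\<Sum>is\<in>?I. T (K n (map \<eta> is)) x)"
      by (intro sum finite_index_lists cont)
    ultimately show ?thesis by eventually_elim simp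
  qed
  then have "AE x in lebesgue_on \<Omega>. \<forall>n\<in>{2..m}. T (K n (replicate n (\<eta>_sum m))) x
      = (\<Sum>is | set is \<subseteq> {1..m} \<and> length is = n. T (K n (map \<eta> is)) x)"
    by (intro AE_finite_allI) auto
  then show ?thesis
  proof eventually_elim
    case (elim x)
    define t where "t is = T (K (length is) (map \<eta> is)) x" for "is"
    have split: "(\<Sum>is | set is \<subseteq> {1..m} \<and> length is = n. t is)
        = (\<Sum>is | set is \<subseteq> {1..m} \<and> length is = n \<and> sum_list is \<le> m. t is)
        + (\<Sum>is | set is \<subseteq> {1..m} \<and> length is = n \<and> m < sum_list is. t is)" for n
      by (subst sum.union_disjoint[symmetric])
         (auto intro!: sum.cong finite_subset[OF _ finite_index_lists[of m n]])
    have "\<eta>_sum m x = \<eta> 1 x + (\<Sum>j = 2..m. \<eta> j x)"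
      using m by (subst sum.atLeast_Suc_atMost) (auto simp: numeral_2_eq_2)
    also have "(\<Sum>j = 2..m. \<eta> j x) = - (\<Sum>j = 2..m. \<Sum>n = 2..j. \<Sum>is\<in>compositions n j. t is)"
    proof -
      have "\<eta> j x = - (\<Sum>n = 2..j. \<Sum>is\<in>compositions n j. t is)" if "j \<in> {2..m}" for j
        using that by (subst \<eta>_rec) (auto simp: t_def compositions_def intro!: sum.cong)
      then show ?thesis by (simp add: sum_negf)
    qed
    also have "(\<Sum>j = 2..m. \<Sum>n = 2..j. \<Sum>is\<in>compositions n j. t is)
        = (\<Sum>n = 2..m. \<Sum>is | set is \<subseteq> {1..m} \<and> length is = n. t is)
        - (\<Sum>n = 2..m. \<Sum>is | set is \<subseteq> {1..m} \<and> length is = n \<and> m < sum_list is. t is)"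
      unfolding sum_compositions split sum.distrib by simp
    also have "(\<Sum>n = 2..m. \<Sum>is | set is \<subseteq> {1..m} \<and> length is = n \<and> m < sum_list is. t is) = remainder m x"
      by (auto simp: remainder_def t_def intro!: sum.cong)
    also have "(\<Sum>n = 2..m. \<Sum>is | set is \<subseteq> {1..m} \<and> length is = n. t is)
        = (\<Sum>n = 2..m. T (K n (replicate n (\<eta>_sum m))) x)"
      using elim by (auto simp: t_def intro!: sum.cong)
    finally show ?case unfolding \<eta>_one by linarith
  qed
qed

text \<open>Up to the remainder and up to the truncation error \<open>e\<close> of the Born series, both \<open>\<beta>\<close> and the partial sum
  \<open>b\<close> solve \<open>b = T \<phi> - (\<Sum>n\<ge>2. T (K n (b, ..., b))) + defect\<close>, where the defect of \<open>\<beta>\<close> is \<open>\<beta> - T (K 1 \<beta>)\<close>.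
  Subtracting leaves the nonlinear terms, whose Lipschitz constant on the ball of radius \<open>Q\<close> is at most
  \<open>(\<Sum>n\<ge>2. n * \<sigma> * (p * Q) ^ (n - 1))\<close>.\<close>

lemma error_le:
  assumes m: "m \<ge> 1" and \<beta>: "\<beta> \<in> Linf \<Omega>"
    and Q: "Linf_norm \<Omega> \<beta> \<le> Q" "Linf_norm \<Omega> (\<eta>_sum m) \<le> Q" "p * Q < 1"
    and born: "\<And>z. z \<in> bdry2 \<Omega> \<Longrightarrow> \<bar>(\<Sum>j = 1..m. K j (replicate j \<beta>) z) - \<phi> z\<bar> \<le> e"
  shows "Linf_norm \<Omega> (\<lambda>x. \<beta> x - \<eta>_sum m x)
    \<le> Linf_norm \<Omega> (\<lambda>x. \<beta> x - T (K 1 [\<beta>]) x) + \<kappa> * e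
      + \<sigma> * (1 / (1 - p * Q)\<^sup>2 - 1) * Linf_norm \<Omega> (\<lambda>x. \<beta> x - \<eta>_sum m x) + 2 * \<delta> / 2 ^ m"
proof -
  let ?b = "\<eta>_sum m"
  let ?D = "Linf_norm \<Omega> (\<lambda>x. \<beta> x - ?b x)"
  have Q0: "0 \<le> Q" using Q(1) Linf_norm_nonneg[of \<Omega> \<beta>] by linarith
  have cont_\<beta>: "continuous_on (bdry2 \<Omega>) (K n (replicate n \<beta>))" for n
    by (intro K_continuous) (use \<beta> in auto)
  have cont_b: "continuous_on (bdry2 \<Omega>) (K n (replicate n ?b))" for n
    by (intro K_continuous) (use \<eta>_sum_Linf in auto)
  let ?S = "\<lambda>z. \<Sum>j = 1..m. K j (replicate j \<beta>) z"
  let ?d = "\<lambda>n z. K n (replicate n \<beta>) z - K n (replicate n ?b) z"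
  have cont_S: "continuous_on (bdry2 \<Omega>) ?S"
    by (intro continuous_on_sum cont_\<beta>)
  have cont_e: "continuous_on (bdry2 \<Omega>) (\<lambda>z. ?S z - \<phi> z)"
    by (intro continuous_intros cont_S \<phi>_cont)
  have cont_d: "continuous_on (bdry2 \<Omega>) (?d n)" for n
    by (intro continuous_intros cont_\<beta> cont_b)
  let ?f1 = "\<lambda>x. \<beta> x - T (K 1 [\<beta>]) x" and ?f2 = "T (\<lambda>z. ?S z - \<phi> z)"
    and ?f3 = "\<lambda>x. \<Sum>n = 2..m. T (?d n) x"
  have L1: "?f1 \<in> Linf \<Omega>"
    using cont_\<beta>[of 1] by (intro Linf_diff \<beta> in_Linf) simp
  have L2: "?f2 \<in> Linf \<Omega>" by (intro in_Linf cont_e)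
  have L3: "?f3 \<in> Linf \<Omega>" by (intro Linf_sum in_Linf cont_d)
  have n2: "Linf_norm \<Omega> ?f2 \<le> \<kappa> * e"
    by (rule norm_le[OF cont_e born])
  have n3: "Linf_norm \<Omega> ?f3 \<le> \<sigma> * (1 / (1 - p * Q)\<^sup>2 - 1) * ?D"
  proof -
    have "Linf_norm \<Omega> ?f3 \<le> (\<Sum>n = 2..m. Linf_norm \<Omega> (T (?d n)))"
      by (intro Linf_norm_sum in_Linf cont_d)
    also have "\<dots> \<le> (\<Sum>n = 2..m. \<sigma> * (real n * (p * Q) ^ (n - 1)) * ?D)"
    proof (rule sum_mono)
      fix n assume n: "n \<in> {2..m}"
      have "Linf_norm \<Omega> (T (?d n)) \<le> \<kappa> * (real n * a n * Q ^ (n - 1) * ?D)"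
        using bdry_subset
        by (intro norm_le[OF cont_d] bounded_multilinear_diff_le[OF K a_nonneg \<beta> \<eta>_sum_Linf Q(1,2)]) auto
      also have "\<dots> = (\<kappa> * a n) * (real n * Q ^ (n - 1) * ?D)"
        by (simp add: mult_ac)
      also have "\<dots> \<le> (\<sigma> * p ^ (n - 1)) * (real n * Q ^ (n - 1) * ?D)"
        using n Q0 by (intro mult_right_mono a_le mult_nonneg_nonneg Linf_norm_nonneg) auto
      finally show "Linf_norm \<Omega> (T (?d n)) \<le> \<sigma> * (real n * (p * Q) ^ (n - 1)) * ?D"
        by (simp add: power_mult_distrib mult_ac)
    qed
    also have "\<dots> = \<sigma> * (\<Sum>n = 2..m. real n * (p * Q) ^ (n - 1)) * ?D"
      by (simp add: sum_distrib_left sum_distrib_right)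
    also have "\<dots> \<le> \<sigma> * (1 / (1 - p * Q)\<^sup>2 - 1) * ?D"
      using p Q0 Q(3) by (intro mult_right_mono mult_left_mono sum_Suc_power_le \<sigma> Linf_norm_nonneg) auto
    finally show ?thesis .
  qed
  have "AE x in lebesgue_on \<Omega>. \<beta> x - ?b x = ?f1 x + ?f2 x - ?f3 x - remainder m x"
  proof -
    have d: "AE x in lebesgue_on \<Omega>. \<forall>n\<in>{2..m}. T (?d n) x
        = T (K n (replicate n \<beta>)) x - T (K n (replicate n ?b)) x"
      by (intro AE_finite_allI diff cont_\<beta> cont_b) auto
    have S: "AE x in lebesgue_on \<Omega>. T ?S x = (\<Sum>j = 1..m. T (K j (replicate j \<beta>)) x)"
      by (intro sum cont_\<beta>) auto
    show ?thesis
      using \<eta>_sum_identity[OF m] d S diff[OF cont_S \<phi>_cont]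
    proof eventually_elim
      case (elim x)
      have "(\<Sum>j = 1..m. T (K j (replicate j \<beta>)) x) = T (K 1 [\<beta>]) x + (\<Sum>n = 2..m. T (K n (replicate n \<beta>)) x)"
        using m by (subst sum.atLeast_Suc_atMost) (auto simp: numeral_2_eq_2)
      moreover have "?f3 x = (\<Sum>n = 2..m. T (K n (replicate n \<beta>)) x) - (\<Sum>n = 2..m. T (K n (replicate n ?b)) x)"
        using elim(2) by (simp add: sum_subtractf)
      ultimately show ?case using elim(1,3,4) by linarith
    qed
  qed
  then have "?D = Linf_norm \<Omega> (\<lambda>x. ?f1 x + ?f2 x - ?f3 x - remainder m x)"
    by (intro Linf_norm_cong_AE Linf_add Linf_diff L1 L2 L3 remainder_Linf \<beta> \<eta>_sum_Linf)
  also have "\<dots> \<le> Linf_norm \<Omega> ?f1 + Linf_norm \<Omega> ?f2 + Linf_norm \<Omega> ?f3 + Linf_norm \<Omega> (remainder m)"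
    by (intro order_trans[OF Linf_norm_diff_triangle] order_trans[OF Linf_norm_triangle] add_mono
        order_refl Linf_add Linf_diff L1 L2 L3 remainder_Linf)
  finally show ?thesis
    using n2 n3 norm_remainder_le[of m] by linarith
qed

end

section \<open>The error estimate\<close>

theorem theorem2:
  fixes \<Omega> :: "'a::euclidean_space set"
    and k :: real
    and G :: "'a \<Rightarrow> 'a \<Rightarrow> real"
    and g :: "'a \<Rightarrow> 'a \<Rightarrow> real"
    and u0 :: "'a \<times> 'a \<Rightarrow> real"
    and K1inv :: "('a \<times> 'a \<Rightarrow> real) \<Rightarrow> 'a \<Rightarrow> real"
    and K :: "nat \<Rightarrow> 'a multiop"
    and \<beta> \<beta>' :: "'a \<Rightarrow> real"
    and \<phi> :: "'a \<times> 'a \<Rightarrow> real"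
    and \<mu> N \<kappa> C r M :: real
  assumes dim: "DIM('a) \<ge> 2"
    and domain: "smooth_bounded_domain \<Omega>"
    and not_eigenvalue: "\<not> neumann_eigenvalue \<Omega> (- k\<^sup>2)"
    and green: "neumann_green \<Omega> k G"
    and u0_cont: "continuous_on (closure \<Omega> \<times> frontier \<Omega>) u0"
    and u0_sol: "\<And>s. s \<in> frontier \<Omega> \<Longrightarrow>
                   neumann_solution \<Omega> (- k\<^sup>2) (g s) (\<lambda>x. u0 (x, s))"
    and u0_nonzero: "\<exists>z\<in>closure \<Omega> \<times> frontier \<Omega>. u0 z \<noteq> 0"
    and K_def: "K = born \<Omega> k G u0"
    and K1inv: "bounded_linear_C_Linf \<Omega> K1inv"
    and mu_def: "\<mu> = k\<^sup>2 * (SUP x\<in>\<Omega>. LINT y|lebesgue_on \<Omega>. \<bar>G x y\<bar>)"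
    and N_def: "N = sup_norm (closure \<Omega> \<times> frontier \<Omega>) u0"
    and kappa_def: "\<kappa> = onorm_C_Linf \<Omega> K1inv"
    and C_def: "C = max 2 (81/8 * \<mu> * \<kappa> * N^3)"
    and r_def: "r = 2 / (27 * \<mu> * N\<^sup>2) * (sqrt (16 * C\<^sup>2 + 1) - 4 * C)"
    and beta: "\<beta> \<in> Linf \<Omega>"
    and phi: "continuous_on (bdry2 \<Omega>) \<phi>"
    and born_converges:
      "uniform_limit (bdry2 \<Omega>) (\<lambda>n z. \<Sum>j = 1..n. K j (replicate j \<beta>) z) \<phi> sequentially"
    and small_data: "Linf_norm \<Omega> (K1inv \<phi>) < r"
    and beta': "\<beta>' \<in> Linf \<Omega>"
    and inverse_born_converges:
      "(\<lambda>n. Linf_norm \<Omega> (\<lambda>x. (\<Sum>m = 1..n. inverse_born K K1inv \<phi> m x) - \<beta>' x)) \<longlonglongrightarrow> 0"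
    and M_def: "M = max (Linf_norm \<Omega> \<beta>) (Linf_norm \<Omega> \<beta>')"
    and M_small: "M < 4 / (27 * \<mu> * N\<^sup>2) *
                    (1 - sqrt ((81/8 * \<mu> * \<kappa> * N^3) / (1 + 81/8 * \<mu> * \<kappa> * N^3)))"
  shows "Linf_norm \<Omega> (\<lambda>x. \<beta> x - \<beta>' x)
         \<le> inverse (1 - (81/8 * \<mu> * \<kappa> * N^3) / (1 - 27/4 * \<mu> * N\<^sup>2 * M)\<^sup>2
                      + 81/8 * \<mu> * \<kappa> * N^3)
           * Linf_norm \<Omega> (\<lambda>x. \<beta> x - K1inv (K 1 [\<beta>]) x)"
proof -
  define p where "p = 27/4 * \<mu> * N\<^sup>2"
  define \<sigma> where "\<sigma> = 81/8 * \<mu> * \<kappa> * N^3"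
  define a where "a n = N ^ (2 * n + 1) * \<mu> ^ n * ternary_trees n" for n
  have open_\<Omega>: "open \<Omega>" "bounded \<Omega>" "\<Omega> \<noteq> {}"
    using domain by (auto simp: smooth_bounded_domain_def)
  have frontier: "frontier \<Omega> \<noteq> {}"
    using u0_nonzero by auto
  have "weakly_singular \<Omega> G" using green by (simp add: neumann_green_def)
  then obtain w where "singular_kernel \<Omega> G w"
    using weakly_singular_imp_singular_kernel open_\<Omega> by blast
  then interpret G: singular_kernel \<Omega> G w .
  have compact: "compact (closure \<Omega> \<times> frontier \<Omega>)"
    using open_\<Omega> by (intro compact_Times compact_frontier_bounded) (simp_all add: compact_closure)
  have u0_le: "\<bar>u0 z\<bar> \<le> N" if "z \<in> closure \<Omega> \<times> frontier \<Omega>" for z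
    unfolding N_def by (rule abs_le_sup_norm[OF compact u0_cont that])
  obtain z0 where "z0 \<in> closure \<Omega> \<times> frontier \<Omega>" "u0 z0 \<noteq> 0"
    using u0_nonzero by blast
  then have N: "N > 0" using u0_le[of z0] by linarith
  have M0: "0 \<le> M" by (simp add: M_def Linf_norm_nonneg le_max_iff_disj)
  \<comment> \<open>For \<open>\<mu> = 0\<close> the bound on \<open>M\<close> would read \<open>M < 0\<close>, as division by zero yields zero.\<close>
  have "\<mu> \<noteq> 0"
  proof
    assume "\<mu> = 0"
    then show False using M_small M0 by simp
  qed
  moreover have "0 \<le> \<mu>"
  proof -
    obtain x0 where x0: "x0 \<in> closure \<Omega>" using open_\<Omega> closure_subset by blast
    have "0 \<le> (LINT y|lebesgue_on \<Omega>. \<bar>G x0 y\<bar>)" by simp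
    also have "\<dots> \<le> (SUP x\<in>\<Omega>. LINT y|lebesgue_on \<Omega>. \<bar>G x y\<bar>)"
      by (rule G.integral_abs_kernel_le[OF x0])
    finally show ?thesis by (simp add: mu_def)
  qed
  ultimately have \<mu>: "\<mu> > 0" by simp
  have p: "p > 0" using \<mu> N by (simp add: p_def)
  interpret T: boundary_operator \<Omega> K1inv
    by unfold_locales (use open_\<Omega> frontier K1inv in auto)
  have \<kappa>: "0 \<le> \<kappa>" using T.onorm_nonneg by (simp add: kappa_def)
  have \<sigma>: "0 \<le> \<sigma>" using \<mu> N \<kappa> by (simp add: \<sigma>_def)
  define \<delta> where "\<delta> = Linf_norm \<Omega> (K1inv \<phi>)"
  have C: "C \<ge> 2" "C \<ge> \<sigma>" by (auto simp: C_def \<sigma>_def)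
  \<comment> \<open>The radius \<open>r\<close> enters only through \<open>p * r = (sqrt (16 C^2 + 1) - 4 C) / 2\<close>, which is below \<open>1 / (16 C)\<close>.\<close>
  have p\<delta>: "p * \<delta> \<le> 1 / (16 * C)"
  proof -
    have "sqrt (16 * C\<^sup>2 + 1) \<le> 4 * C + 1 / (8 * C)"
    proof (rule real_le_lsqrt)
      show "16 * C\<^sup>2 + 1 \<le> (4 * C + 1 / (8 * C))\<^sup>2"
        using C by (simp add: power2_sum power_mult_distrib)
    qed (use C in auto)
    then have "(sqrt (16 * C\<^sup>2 + 1) - 4 * C) / 2 \<le> 1 / (16 * C)"
      by simp
    moreover have "p * r = (sqrt (16 * C\<^sup>2 + 1) - 4 * C) / 2"
      using \<mu> N by (simp add: p_def r_def field_simps)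
    moreover have "p * \<delta> \<le> p * r"
      using small_data p by (intro mult_left_mono) (auto simp: \<delta>_def)
    ultimately show ?thesis by linarith
  qed
  interpret inverse_born_series \<Omega> K1inv K a p \<sigma> \<delta> \<phi>
  proof
    show "bounded_multilinear \<Omega> n (a n) (K n)" for n
      unfolding a_def K_def by (rule G.bounded_multilinear_born[OF u0_cont u0_le mu_def])
    show "0 \<le> a n" for n
      using N \<mu> by (simp add: a_def ternary_trees_nonneg)
    show "onorm_C_Linf \<Omega> K1inv * a n \<le> \<sigma> * p ^ (n - 1)" if n: "n \<ge> 2" for n
    proof -
      have "\<kappa> * a n \<le> \<kappa> * (N ^ (2 * n + 1) * \<mu> ^ n * (3/2 * (27/4) ^ n))"
        unfolding a_def using N \<mu> \<kappa> by (intro mult_left_mono ternary_trees_le) auto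
      also have "\<dots> = \<sigma> * p ^ (n - 1)"
      proof -
        obtain j where j: "n = Suc j" using n by (cases n) auto
        have "p ^ j = (27/4) ^ j * \<mu> ^ j * N ^ (2 * j)"
          by (simp only: p_def power_mult_distrib power_mult)
        moreover have "N ^ (2 * n + 1) = N ^ 3 * N ^ (2 * j)"
          unfolding j by (simp add: power3_eq_cube)
        ultimately show ?thesis
          by (simp add: j \<sigma>_def)
      qed
      finally show ?thesis by (simp add: kappa_def)
    qed
    have "1 / (16 * C) \<le> 1 / 32" using C by (simp add: field_simps)
    then show "4 * (p * \<delta>) \<le> 1/2" using p\<delta> by linarith
    have "16 * \<sigma> * (p * \<delta>) \<le> 16 * C * (1 / (16 * C))"
      using p\<delta> C \<sigma> p by (intro mult_mono) (auto simp: \<delta>_def Linf_norm_nonneg)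
    then show "16 * \<sigma> * (p * \<delta>) \<le> 1" using C by simp
  qed (use p \<sigma> phi in \<open>auto simp: \<delta>_def\<close>)
  define x where "x = Linf_norm \<Omega> (\<lambda>x. \<beta> x - \<beta>' x)"
  define y where "y = Linf_norm \<Omega> (\<lambda>x. \<beta> x - K1inv (K 1 [\<beta>]) x)"
  define xm where "xm m = Linf_norm \<Omega> (\<lambda>x. \<beta> x - \<eta>_sum m x)" for m
  define dev where "dev m = Linf_norm \<Omega> (\<lambda>x. \<eta>_sum m x - \<beta>' x)" for m
  have dev: "dev \<longlonglongrightarrow> 0"
    using inverse_born_converges by (simp add: dev_def[abs_def])
  have dev_sym: "Linf_norm \<Omega> (\<lambda>x. \<beta>' x - \<eta>_sum m x) = dev m" for m
    unfolding dev_def by (rule Linf_norm_minus_commute)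
  have xm: "xm \<longlonglongrightarrow> x"
  proof (rule Lim_transform[OF tendsto_const[of x]], rule Lim_null_comparison[OF _ dev])
    have "\<bar>x - xm m\<bar> \<le> dev m" for m
    proof -
      have "x \<le> xm m + dev m"
        using Linf_norm_triangle[OF Linf_diff[OF beta \<eta>_sum_Linf] Linf_diff[OF \<eta>_sum_Linf beta'], of m m]
        by (simp add: x_def xm_def dev_def)
      moreover have "xm m \<le> x + dev m"
        using Linf_norm_triangle[OF Linf_diff[OF beta beta'] Linf_diff[OF beta' \<eta>_sum_Linf], of m]
        by (simp add: x_def xm_def flip: dev_sym)
      ultimately show ?thesis by linarith
    qed
    then show "\<forall>\<^sub>F m in sequentially. norm (xm m - x) \<le> dev m"
      by (simp add: abs_minus_commute)
  qed
  have q: "p * M < 1 - sqrt (\<sigma> / (1 + \<sigma>))"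
  proof -
    have "p * M < p * (4 / (27 * \<mu> * N\<^sup>2) * (1 - sqrt (\<sigma> / (1 + \<sigma>))))"
      unfolding \<sigma>_def by (rule mult_strict_left_mono[OF M_small p])
    also have "\<dots> = 1 - sqrt (\<sigma> / (1 + \<sigma>))"
      using \<mu> N by (simp add: p_def)
    finally show ?thesis .
  qed
  have q1: "p * M < 1"
    using q \<sigma> real_sqrt_ge_zero[of "\<sigma> / (1 + \<sigma>)"] by (auto intro: less_le_trans)
  \<comment> \<open>The Lipschitz constant of the nonlinear part on the ball of radius \<open>M\<close>; the bound on \<open>M\<close> says that it
    is below \<open>1\<close>.\<close>
  define L where "L = \<sigma> * (1 / (1 - p * M)\<^sup>2 - 1)"
  have L: "L < 1"
  proof -
    have "\<sigma> / (1 + \<sigma>) = (sqrt (\<sigma> / (1 + \<sigma>)))\<^sup>2"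
      using \<sigma> by simp
    also have "\<dots> < (1 - p * M)\<^sup>2"
      using q \<sigma> by (intro power_strict_mono) auto
    finally have "\<sigma> < (1 - p * M)\<^sup>2 * (1 + \<sigma>)"
      using \<sigma> by (simp add: divide_less_eq)
    then have "\<sigma> / (1 - p * M)\<^sup>2 < 1 + \<sigma>"
      using q1 by (simp add: divide_less_eq mult.commute)
    then show ?thesis by (simp add: L_def right_diff_distrib)
  qed
  \<comment> \<open>The partial sums may leave the ball of radius \<open>M\<close>, by at most \<open>dev m\<close>.\<close>
  have Q: "(\<lambda>m. p * (M + dev m)) \<longlonglongrightarrow> p * M"
    using tendsto_mult_left[OF tendsto_add[OF tendsto_const dev], of p M] by simp
  have "x \<le> y + L * x"
  proof (rule field_le_epsilon)
    fix e :: real assume e: "e > 0"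
    have "0 < e / (\<kappa> + 1)" using e \<kappa> by simp
    with born_converges have "\<forall>\<^sub>F m in sequentially. \<forall>z\<in>bdry2 \<Omega>.
        dist (\<Sum>j = 1..m. K j (replicate j \<beta>) z) (\<phi> z) < e / (\<kappa> + 1)"
      by (rule uniform_limitD)
    moreover have "\<forall>\<^sub>F m in sequentially. p * (M + dev m) < 1"
      using order_tendstoD(2)[OF Q q1] .
    ultimately have "\<forall>\<^sub>F m in sequentially.
        xm m \<le> y + e + \<sigma> * (1 / (1 - p * (M + dev m))\<^sup>2 - 1) * xm m + 2 * \<delta> / 2 ^ m"
      using eventually_ge_at_top[of 1]
    proof eventually_elim
      case (elim m)
      have "Linf_norm \<Omega> (\<lambda>x. (\<eta>_sum m x - \<beta>' x) + \<beta>' x) \<le> dev m + Linf_norm \<Omega> \<beta>'"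
        unfolding dev_def by (rule Linf_norm_triangle[OF Linf_diff[OF \<eta>_sum_Linf beta'] beta'])
      then have b: "Linf_norm \<Omega> (\<eta>_sum m) \<le> M + dev m"
        by (simp add: M_def)
      have \<beta>: "Linf_norm \<Omega> \<beta> \<le> M + dev m"
        using Linf_norm_nonneg[of \<Omega> "\<lambda>x. \<eta>_sum m x - \<beta>' x"] by (simp add: M_def dev_def)
      have "xm m \<le> y + \<kappa> * (e / (\<kappa> + 1)) + \<sigma> * (1 / (1 - p * (M + dev m))\<^sup>2 - 1) * xm m + 2 * \<delta> / 2 ^ m"
        unfolding xm_def y_def kappa_def
        by (rule error_le[OF elim(3) beta \<beta> b elim(2)])
           (use elim(1) in \<open>auto simp: dist_real_def kappa_def intro: less_imp_le\<close>)
      moreover have "\<kappa> * (e / (\<kappa> + 1)) \<le> e"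
        using e \<kappa> by (simp add: field_simps)
      ultimately show ?case by linarith
    qed
    moreover have "(\<lambda>m. y + e + \<sigma> * (1 / (1 - p * (M + dev m))\<^sup>2 - 1) * xm m + 2 * \<delta> / 2 ^ m)
        \<longlonglongrightarrow> y + e + L * x + 0"
    proof -
      have "(\<lambda>m. (1 - p * (M + dev m))\<^sup>2) \<longlonglongrightarrow> (1 - p * M)\<^sup>2"
        by (intro tendsto_power tendsto_diff tendsto_const Q)
      then have "(\<lambda>m. 1 / (1 - p * (M + dev m))\<^sup>2) \<longlonglongrightarrow> 1 / (1 - p * M)\<^sup>2"
        using q1 by (intro tendsto_divide tendsto_const) auto
      then have "(\<lambda>m. \<sigma> * (1 / (1 - p * (M + dev m))\<^sup>2 - 1) * xm m) \<longlonglongrightarrow> L * x"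
        unfolding L_def by (intro tendsto_mult tendsto_diff tendsto_const xm)
      then show ?thesis
        by (intro tendsto_add tendsto_const LIMSEQ_divide_realpow_zero) auto
    qed
    ultimately have "x \<le> y + e + L * x + 0"
      by (intro tendsto_le[OF _ _ xm]) auto
    then show "x \<le> y + L * x + e" by simp
  qed
  then have "(1 - L) * x \<le> y" by (simp add: algebra_simps)
  then have "x \<le> inverse (1 - L) * y"
    using L by (simp add: field_simps)
  also have "1 - L = 1 - \<sigma> / (1 - p * M)\<^sup>2 + \<sigma>"
    by (simp add: L_def right_diff_distrib)
  finally show ?thesis
    by (simp only: x_def y_def \<sigma>_def p_def)
qed

end
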